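(* Let $d\ge3$ and $\gamma\in[1,\frac{2d}{d+2})$, and let $\rho$ be a gaseous Lane–Emden profile (which is then defined on $[0,\infty)$) with mass function $m$. Let $\mathbf v^*=(v_1^*,v_2^* )$ with $v_1^*=\big(\frac{1}{2\pi}\frac{-d\gamma^2+2(d-1)\gamma}{(2-\gamma)^2}\big)^{1/(2-\gamma)}$ and $v_2^*=\frac{2\gamma}{2-\gamma}\big(\frac{1}{2\pi}\frac{-d\gamma^2+2(d-1)\gamma}{(2-\gamma)^2}\big)^{(\gamma-1)/(2-\gamma)}$. Then there exist constants $c>0$ and $K>0$ such that for all $r>0$, $$\big|r^{2/(2-\gamma)}\rho(r)-v_1^*\big|\le Kr^{-c},\qquad\big|r^{2/(2-\gamma)-d}m(r)-v_2^*\big|\le Kr^{-c}.$$ In particular the profile is asymptotic as $r\to\infty$ to the singular solution $v_1^*r^{-2/(2-\gamma)}$.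
   Context: Fix an integer $d\ge 3$ and $\gamma\in[1,2]$. For $\rho_0>0$, the (radial, gaseous) Lane–Emden profile with central density $\rho_0$ is the unique continuous function $\rho:[0,R_g)\to(0,\infty)$, defined on its maximal interval of existence $[0,R_g)$, $R_g\in(0,\infty]$, with $\rho(0)=\rho_0$ and, writing $m(r)=4\pi\int_0^r y^{d-1}\rho(y)\,dy$ (the mass function), $\frac{d}{dr}\big(\rho(r)^\gamma\big)=-\rho(r)\,m(r)/r^{d-1}$ for $0<r<R_g$. *)

theory Defs
  imports "HOL-Analysis.Analysis"
begin

text \<open>Mass function of a radial density rho in dimension d (paper's normalisation 4 pi).\<close>
definition LE_mass :: "nat \<Rightarrow> (real \<Rightarrow> real) \<Rightarrow> real \<Rightarrow> real" where
  "LE_mass d \<rho> r = 4 * pi * integral {0..r} (\<lambda>y. y ^ (d - 1) * \<rho> y)"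

definition LE_solution :: "nat \<Rightarrow> real \<Rightarrow> real \<Rightarrow> (real \<Rightarrow> real) \<Rightarrow> ereal \<Rightarrow> bool" where
  "LE_solution d \<gamma> \<rho>0 \<rho> R \<longleftrightarrow>
     0 < R \<and> \<rho> 0 = \<rho>0 \<and>
     continuous_on {r. 0 \<le> r \<and> ereal r < R} \<rho> \<and>
     (\<forall>r. 0 \<le> r \<and> ereal r < R \<longrightarrow> 0 < \<rho> r) \<and>
     (\<forall>r. 0 < r \<and> ereal r < R \<longrightarrow>
        ((\<lambda>s. \<rho> s powr \<gamma>) has_real_derivative
           (- \<rho> r * LE_mass d \<rho> r / r ^ (d - 1))) (at r))"

definition LE_profile :: "nat \<Rightarrow> real \<Rightarrow> real \<Rightarrow> (real \<Rightarrow> real) \<Rightarrow> ereal \<Rightarrow> bool" where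
  "LE_profile d \<gamma> \<rho>0 \<rho> Rg \<longleftrightarrow>
     LE_solution d \<gamma> \<rho>0 \<rho> Rg \<and>
     \<not> (\<exists>R' \<rho>'. Rg < R' \<and> LE_solution d \<gamma> \<rho>0 \<rho>' R' \<and>
          (\<forall>r. 0 \<le> r \<and> ereal r < Rg \<longrightarrow> \<rho>' r = \<rho> r))"

end

theory Submission
  imports Defs
begin

text \<open>
  Put \<open>\<alpha> = 2 / (2 - \<gamma>)\<close>, \<open>X = r powr \<alpha> * \<rho>\<close>, \<open>Y = r powr (\<alpha> - d) * m\<close> and
  \<open>P = \<alpha> * X powr (\<gamma> - 1) - Y / \<gamma>\<close>. In the variable \<open>ln r\<close> the Lane--Emden equation becomes the
  damped oscillator \<open>X' = X powr (2 - \<gamma>) * P\<close>, \<open>P' = - \<delta> * P - g X\<close>, whose damping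
  \<open>\<delta> = d - \<alpha> * \<gamma>\<close> is positive exactly when \<open>\<gamma> < 2 d / (d + 2)\<close>. The energy \<open>P\<^sup>2 / 2 + V X\<close> is
  nonincreasing and traps \<open>X\<close> in a compact subinterval of the positive half-line. Since \<open>g\<close> vanishes only
  at the density of the singular solution, where it changes sign, a cross-term perturbation of the
  energy decays like a power of \<open>r\<close>. The trapping also bounds \<open>\<rho>\<close> away from \<open>0\<close> on bounded intervals,
  so that a profile stopping at a finite radius could be continued by Picard iteration.
\<close>

subsection \<open>Decay of damped oscillators\<close>

text \<open>The obstacle is the lower bound on \<open>X\<close>. At \<gamma> = 1 the potential
  contains a logarithm and every energy level confines \<open>X\<close>. For \<gamma> > 1 the
  potential stays bounded near 0, and dissipation alone does not exclude that \<open>X\<close>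
  drifts to 0. What excludes it is a negative energy at some radius, and this comes from the regular
  centre: the mass is O(r^d) there, so \<open>Y\<close> is negligible against
  \<open>X powr (\<gamma> - 1)\<close>, and the leading coefficient of the energy has the sign of
  -\<delta>. The bound on \<gamma> thus enters twice, as friction and as the sign of the energy.
  Once \<open>X\<close> is trapped, the single zero of \<open>g\<close> makes the potential
  quadratic from both sides on the whole trap, so the Lyapunov estimate holds from the trapping
  radius on, without a separate local analysis at the rest point. Exponential decay in
  \<open>ln r\<close> is power decay in \<open>r\<close>.\<close>

lemma nonneg_if_derivative_sign:
  fixes f :: "real \<Rightarrow> real"
  assumes "z \<in> {a..b}" "x \<in> {a..b}" "f z \<ge> 0"
    and der: "\<And>u. u \<in> {a..b} \<Longrightarrow> (f has_real_derivative f' u) (at u)"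
    and sgn: "\<And>u. u \<in> {a..b} \<Longrightarrow> f' u * (u - z) \<ge> 0"
  shows "f x \<ge> 0"
proof (cases x z rule: linorder_cases)
  case less
  obtain u where u: "x < u" "u < z" "f z - f x = (z - x) * f' u"
    using MVT2[of x z f f'] der assms less by auto
  have "f' u \<le> 0" using sgn[of u] u assms by (auto simp: zero_le_mult_iff)
  then show ?thesis using u less \<open>f z \<ge> 0\<close> mult_nonneg_nonpos[of "z - x" "f' u"] by linarith
next
  case greater
  obtain u where u: "z < u" "u < x" "f x - f z = (x - z) * f' u"
    using MVT2[of z x f f'] der assms greater by auto
  have "f' u \<ge> 0" using sgn[of u] u assms by (auto simp: zero_le_mult_iff)
  then show ?thesis using u greater \<open>f z \<ge> 0\<close> mult_nonneg_nonneg[of "x - z" "f' u"] by linarith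
qed (use assms in auto)

text \<open>Mean value theorem with the factor \<open>s\<close> kept outside \<open>k\<close>. Then
  \<open>k\<close> has positive bounds for every \<open>s\<close>, including \<open>s = 0\<close>,
  which occurs below as \<gamma> - 1 in the isothermal case.\<close>

lemma powr_diff_bounds:
  fixes a b s :: real
  assumes "0 < a" "a \<le> b"
  obtains lo hi where "0 < lo" "0 < hi"
    "\<And>x y. x \<in> {a..b} \<Longrightarrow> y \<in> {a..b} \<Longrightarrow>
       \<exists>k\<in>{lo..hi}. x powr s - y powr s = s * k * (x - y)"
proof -
  \<comment> \<open>\<open>u powr (s - 1)\<close> increases for s \<ge> 1 and decreases for s \<le>
    1; taking minimum and maximum of the endpoint values covers both.\<close>
  define lo hi where "lo = min (a powr (s - 1)) (b powr (s - 1))"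
    and "hi = max (a powr (s - 1)) (b powr (s - 1))"
  have k: "u powr (s - 1) \<in> {lo..hi}" if "u \<in> {a..b}" for u
  proof (cases "s \<ge> 1")
    case True
    then have "a powr (s - 1) \<le> u powr (s - 1)" "u powr (s - 1) \<le> b powr (s - 1)"
      using that assms by (auto intro!: powr_mono2)
    then show ?thesis by (auto simp: lo_def hi_def)
  next
    case False
    then have "b powr (s - 1) \<le> u powr (s - 1)" "u powr (s - 1) \<le> a powr (s - 1)"
      using that assms by (auto intro!: powr_mono2')
    then show ?thesis by (auto simp: lo_def hi_def)
  qed
  have lt: "\<exists>k\<in>{lo..hi}. x powr s - y powr s = s * k * (x - y)"
    if "x \<in> {a..b}" "y \<in> {a..b}" "y < x" for x y
  proof -
    have "\<exists>u>y. u < x \<and> x powr s - y powr s = (x - y) * (s * u powr (s - 1))"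
    proof (rule MVT2[OF \<open>y < x\<close>])
      fix u assume "y \<le> u" "u \<le> x"
      then show "((\<lambda>u. u powr s) has_real_derivative s * u powr (s - 1)) (at u)"
        using that assms by (intro has_real_derivative_powr) auto
    qed
    then obtain u where u: "y < u" "u < x" "x powr s - y powr s = (x - y) * (s * u powr (s - 1))"
      by blast
    then show ?thesis using k[of u] that by (intro bexI[of _ "u powr (s - 1)"]) auto
  qed
  have "\<exists>k\<in>{lo..hi}. x powr s - y powr s = s * k * (x - y)"
    if xy: "x \<in> {a..b}" "y \<in> {a..b}" for x y
  proof (cases x y rule: linorder_cases)
    case less
    obtain k where "k \<in> {lo..hi}" "y powr s - x powr s = s * k * (y - x)"
      using lt[OF xy(2,1) less] by blast
    then show ?thesis by (intro bexI[of _ k]) (auto simp: algebra_simps)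
  next
    case equal
    then show ?thesis using k[OF xy(1)] by auto
  qed (use lt xy in blast)
  moreover have "0 < lo" "0 < hi"
    using assms by (simp_all add: lo_def hi_def less_max_iff_disj)
  ultimately show thesis by (rule_tac that)
qed

text \<open>In the time \<open>ln r\<close> the hypotheses read x' = k(x) p and p' = -\<delta> p -
  g(x). Since W' = g / k, the derivative of W(x) is g(x) p, which cancels the force term in that of
  \<open>p\<^sup>2 / 2\<close>.\<close>

lemma damped_oscillator_decay:
  fixes x p :: "real \<Rightarrow> real" and k g W :: "real \<Rightarrow> real"
  assumes "0 < r0" "0 < \<delta>" "0 < \<kappa>" "0 < c1" "0 < c2" "0 \<le> K" "z \<in> {a..b}"
    and xab: "\<And>r. r \<ge> r0 \<Longrightarrow> x r \<in> {a..b}"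
    and dx: "\<And>r. r \<ge> r0 \<Longrightarrow> (x has_real_derivative k (x r) * p r / r) (at r)"
    and dp: "\<And>r. r \<ge> r0 \<Longrightarrow> (p has_real_derivative (- \<delta> * p r - g (x r)) / r) (at r)"
    and dW: "\<And>u. u \<in> {a..b} \<Longrightarrow> (W has_real_derivative g u / k u) (at u)"
    and k: "\<And>u. u \<in> {a..b} \<Longrightarrow> 0 < k u \<and> k u \<le> K"
    and g: "\<And>u. u \<in> {a..b} \<Longrightarrow> \<kappa> * (u - z)\<^sup>2 \<le> g u * (u - z)"
    and W: "\<And>u. u \<in> {a..b} \<Longrightarrow> c1 * (u - z)\<^sup>2 \<le> W u \<and> W u \<le> c2 * (u - z)\<^sup>2"
  obtains c C where "0 < c" "0 < C"
    "\<And>r. r \<ge> r0 \<Longrightarrow> \<bar>x r - z\<bar> \<le> C * r powr (- c)"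
    "\<And>r. r \<ge> r0 \<Longrightarrow> \<bar>p r\<bar> \<le> C * r powr (- c)"
proof -
  \<comment> \<open>Cost of the cross term per unit of \<epsilon>: \<open>K\<close> bounds
    \<open>k\<close> in its part \<open>k * p\<^sup>2\<close>, and the second summand is the price
    in \<open>p\<^sup>2\<close> of absorbing -\<delta> p (x - z) into half of the gain
    \<open>\<kappa> * (x - z)\<^sup>2\<close> by completing a square.\<close>
  define M where "M = K + \<delta>\<^sup>2 / (2 * \<kappa>)"
  have "M \<ge> 0" using assms by (auto simp: M_def)
  \<comment> \<open>The energy alone only dissipates through \<open>p\<close>; the small cross term \<open>\<epsilon> * p * (x - z)\<close> makes the
    functional \<open>F\<close> below dissipate in \<open>x - z\<close> as well, so that \<open>r * F' \<le> - c * F\<close>.\<close>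
  define \<epsilon> where "\<epsilon> = min (1/2) (min c1 (\<delta> / (2 * (M + 1))))"
  \<comment> \<open>The bounds 1/2 and \<open>c1\<close> keep \<open>F\<close> positive definite
    (\<open>low\<close>); the third one leaves half of the friction after paying for the cross term
    (\<open>eM\<close>).\<close>
  have e: "0 < \<epsilon>" "\<epsilon> \<le> 1/2" "\<epsilon> \<le> c1"
    using \<open>0 < \<delta>\<close> \<open>0 < c1\<close> \<open>M \<ge> 0\<close> unfolding \<epsilon>_def by (simp_all only: min_less_iff_conj min_le_iff_disj) auto
  have "\<epsilon> * M \<le> \<delta> / (2 * (M + 1)) * M"
    using \<open>M \<ge> 0\<close> by (intro mult_right_mono) (auto simp: \<epsilon>_def)
  also have "\<dots> \<le> \<delta> / 2" using \<open>M \<ge> 0\<close> \<open>0 < \<delta>\<close> by (simp add: field_simps)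
  finally have eM: "\<epsilon> * M \<le> \<delta> / 2" .
  \<comment> \<open>Dissipation is at least \<open>\<delta> / 2 * p\<^sup>2 + \<epsilon> * \<kappa>
    / 2 * (x - z)\<^sup>2\<close>, while \<open>F\<close> is at most
    \<open>p\<^sup>2 + (c2 + 1/2) * (x - z)\<^sup>2\<close>; \<open>c\<close> is the smaller of the
    two ratios.\<close>
  define c where "c = min (\<delta> / 2) (\<epsilon> * \<kappa> / (2 * c2 + 1))"
  have c: "0 < c" using assms e by (auto simp: c_def)
  have c_le: "c \<le> \<delta> / 2" "c * (c2 + 1/2) \<le> \<epsilon> * \<kappa> / 2"
  proof -
    show "c \<le> \<delta> / 2" unfolding c_def by (rule min.cobounded1)
    have "c * (c2 + 1/2) \<le> (\<epsilon> * \<kappa> / (2 * c2 + 1)) * (c2 + 1/2)"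
      using assms by (intro mult_right_mono) (auto simp: c_def)
    also have "\<dots> = \<epsilon> * \<kappa> / 2" using assms by (simp add: field_simps)
    finally show "c * (c2 + 1/2) \<le> \<epsilon> * \<kappa> / 2" .
  qed
  define F where "F r = (p r)\<^sup>2 / 2 + W (x r) + \<epsilon> * (p r * (x r - z))" for r
  define F' where "F' r = - \<delta> * (p r)\<^sup>2 + \<epsilon> * k (x r) * (p r)\<^sup>2
      + \<epsilon> * ((- \<delta> * p r - g (x r)) * (x r - z))" for r
  have young: "\<bar>p r * (x r - z)\<bar> \<le> ((p r)\<^sup>2 + (x r - z)\<^sup>2) / 2" for r
  proof -
    have "0 \<le> (\<bar>p r\<bar> - \<bar>x r - z\<bar>)\<^sup>2" by simp
    then show ?thesis by (simp add: power2_diff abs_mult)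
  qed
  have dF: "(F has_real_derivative F' r / r) (at r)" if r: "r \<ge> r0" for r
  proof -
    have "k (x r) \<noteq> 0" using k[OF xab[OF r]] by auto
    have "((\<lambda>s. W (x s)) has_real_derivative g (x r) / k (x r) * (k (x r) * p r / r)) (at r)"
      by (rule DERIV_chain2[OF dW[OF xab[OF r]] dx[OF r]])
    then show ?thesis unfolding F_def F'_def
      using \<open>k (x r) \<noteq> 0\<close> r \<open>0 < r0\<close>
      by (auto intro!: derivative_eq_intros dx[OF r] dp[OF r] simp: field_simps power2_eq_square)
  qed
  have low: "(p r)\<^sup>2 / 4 + c1 / 2 * (x r - z)\<^sup>2 \<le> F r" if r: "r \<ge> r0" for r
  proof -
    have "\<epsilon> * \<bar>p r * (x r - z)\<bar> \<le> \<epsilon> * (((p r)\<^sup>2 + (x r - z)\<^sup>2) / 2)"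
      using young e by (intro mult_left_mono) auto
    moreover have "\<epsilon> * (p r)\<^sup>2 \<le> 1/2 * (p r)\<^sup>2" "\<epsilon> * (x r - z)\<^sup>2 \<le> c1 * (x r - z)\<^sup>2"
      using e by (intro mult_right_mono; simp)+
    moreover have "- (\<epsilon> * \<bar>p r * (x r - z)\<bar>) \<le> \<epsilon> * (p r * (x r - z))"
      using mult_left_mono[of "- \<bar>p r * (x r - z)\<bar>" "p r * (x r - z)" \<epsilon>] e by auto
    ultimately show ?thesis using W[OF xab[OF r]] by (auto simp: F_def field_simps)
  qed
  have decay: "F' r \<le> - c * F r" if r: "r \<ge> r0" for r
  proof -
    let ?z = "x r - z"
    have kz: "\<epsilon> * k (x r) * (p r)\<^sup>2 \<le> \<epsilon> * K * (p r)\<^sup>2"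
      using k[OF xab[OF r]] e by (intro mult_right_mono) auto
    have gz: "\<epsilon> * (\<kappa> * ?z\<^sup>2) \<le> \<epsilon> * (g (x r) * ?z)"
      using g[OF xab[OF r]] e by (intro mult_left_mono) auto
    have "0 \<le> (\<delta> * p r + \<kappa> * ?z)\<^sup>2 / (2 * \<kappa>)" using \<open>\<kappa> > 0\<close> by simp
    also have "\<dots> = \<delta>\<^sup>2 / (2 * \<kappa>) * (p r)\<^sup>2 + \<kappa> / 2 * ?z\<^sup>2 + \<delta> * (p r * ?z)"
      using \<open>\<kappa> > 0\<close> by (simp add: field_simps power2_eq_square)
    finally have "\<epsilon> * (- (\<delta> * (p r * ?z))) \<le> \<epsilon> * (\<delta>\<^sup>2 / (2 * \<kappa>) * (p r)\<^sup>2 + \<kappa> / 2 * ?z\<^sup>2)"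
      using e by (intro mult_left_mono) auto
    then have "F' r \<le> - \<delta> * (p r)\<^sup>2 + \<epsilon> * M * (p r)\<^sup>2 - \<epsilon> * \<kappa> / 2 * ?z\<^sup>2"
      using kz gz unfolding F'_def M_def by (simp add: algebra_simps)
    also have "\<dots> \<le> - (\<delta> / 2) * (p r)\<^sup>2 - \<epsilon> * \<kappa> / 2 * ?z\<^sup>2"
      using mult_right_mono[OF eM, of "(p r)\<^sup>2"] by (simp add: algebra_simps)
    also have "\<dots> \<le> - c * (p r)\<^sup>2 - c * (c2 + 1/2) * ?z\<^sup>2"
      using mult_right_mono[OF c_le(1), of "(p r)\<^sup>2"] mult_right_mono[OF c_le(2), of "?z\<^sup>2"]
      by (simp add: algebra_simps)
    also have "\<dots> = - c * ((p r)\<^sup>2 + (c2 + 1/2) * ?z\<^sup>2)" by (simp add: algebra_simps)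
    also have "\<dots> \<le> - c * F r"
    proof -
      have "\<epsilon> * (p r * ?z) \<le> \<epsilon> * (((p r)\<^sup>2 + ?z\<^sup>2) / 2)"
        using young[of r] e by (intro mult_left_mono) auto
      also have "\<dots> \<le> 1 / 2 * (((p r)\<^sup>2 + ?z\<^sup>2) / 2)" using e by (intro mult_right_mono) auto
      finally have pz: "\<epsilon> * (p r * ?z) \<le> 1 / 2 * (((p r)\<^sup>2 + ?z\<^sup>2) / 2)" .
      have "F r \<le> (p r)\<^sup>2 + (c2 + 1/2) * ?z\<^sup>2"
      proof -
        have arith: "q / 2 + w + u \<le> q + (v + 1/2 * t)"
          if "u \<le> 1/2 * ((q + t) / 2)" "w \<le> v" "0 \<le> q" "0 \<le> t" for q w u v t :: real
          using that by simp
        show ?thesis unfolding F_def distrib_right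
          by (rule arith) (use pz W[OF xab[OF r]] in auto)
      qed
      then show ?thesis using c by (simp add: mult_left_mono)
    qed
    finally show ?thesis .
  qed
  \<comment> \<open>Gronwall in the time \<open>ln r\<close>: the integrating factor exp (c ln r) is
    \<open>r powr c\<close>.\<close>
  have mono: "r powr c * F r \<le> r0 powr c * F r0" if r: "r \<ge> r0" for r
  proof (rule DERIV_nonpos_imp_nonincreasing[OF r])
    fix s assume s: "r0 \<le> s" "s \<le> r"
    then have "0 < s" using \<open>0 < r0\<close> by auto
    have "((\<lambda>r. r powr c * F r) has_real_derivative
        c * s powr (c - 1) * F s + s powr c * (F' s / s)) (at s)"
      using dF[of s] s \<open>0 < s\<close>
      by (auto intro!: derivative_eq_intros has_real_derivative_powr)
    moreover have "c * s powr (c - 1) * F s + s powr c * (F' s / s) = s powr c / s * (c * F s + F' s)"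
      using \<open>0 < s\<close> by (simp add: powr_diff field_simps)
    moreover have "s powr c / s * (c * F s + F' s) \<le> 0"
      using \<open>0 < s\<close> decay[of s] s by (intro mult_nonneg_nonpos) auto
    ultimately show "\<exists>y. ((\<lambda>r. r powr c * F r) has_real_derivative y) (at s) \<and> y \<le> 0" by auto
  qed
  \<comment> \<open>The summand 1 keeps \<open>D\<close> positive when the trajectory already rests
    at \<open>z\<close> and \<open>F r0 = 0\<close>.\<close>
  define D where "D = r0 powr c * F r0 + 1"
  have "F r0 \<ge> 0" using low[of r0] \<open>0 < c1\<close> by (auto intro: order_trans[rotated])
  then have "D > 0" by (simp add: D_def add_nonneg_pos)
  have bd: "F r \<le> D * r powr (- c)" if r: "r \<ge> r0" for r
    using mono[OF r] r \<open>0 < r0\<close> by (simp add: D_def powr_minus field_simps)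
  \<comment> \<open>\<open>F\<close> is quadratic in the unknowns, so their rate is half of the rate
    of \<open>F\<close>.\<close>
  have sq: "\<bar>w\<bar> \<le> sqrt (B * D) * r powr (- (c / 2))"
    if "w\<^sup>2 \<le> B * F r" "B > 0" "r \<ge> r0" for w B r :: real
  proof (rule power2_le_imp_le)
    have "w\<^sup>2 \<le> B * (D * r powr (- c))"
      using that bd[of r] by (auto intro: order_trans)
    also have "\<dots> = (sqrt (B * D) * r powr (- (c / 2)))\<^sup>2"
    proof -
      have "r powr (- c) = (r powr (- (c / 2)))\<^sup>2"
        by (simp add: power2_eq_square flip: powr_add)
      moreover have "(sqrt (B * D))\<^sup>2 = B * D" using that \<open>D > 0\<close> by simp
      ultimately show ?thesis by (simp add: power_mult_distrib)
    qed
    finally show "\<bar>w\<bar>\<^sup>2 \<le> (sqrt (B * D) * r powr (- (c / 2)))\<^sup>2" by simp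
  qed (use that \<open>D > 0\<close> in auto)
  define C where "C = max (sqrt (2 / c1 * D)) (sqrt (4 * D))"
  show thesis
  proof (rule that[of "c / 2" C])
    show "0 < C" using \<open>D > 0\<close> by (auto simp: C_def less_max_iff_disj)
    fix r assume r: "r \<ge> r0"
    have "c1 / 2 * (x r - z)\<^sup>2 \<le> F r"
      using low[OF r] by (rule order_trans[rotated]) simp
    then have "(x r - z)\<^sup>2 \<le> 2 / c1 * F r"
      using \<open>0 < c1\<close> by (simp add: field_simps)
    from sq[OF this _ r] have "\<bar>x r - z\<bar> \<le> sqrt (2 / c1 * D) * r powr (- (c / 2))"
      using \<open>0 < c1\<close> by auto
    also have "\<dots> \<le> C * r powr (- (c / 2))" by (intro mult_right_mono) (auto simp: C_def)
    finally show "\<bar>x r - z\<bar> \<le> C * r powr (- (c / 2))" .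
    have "0 \<le> c1 / 2 * (x r - z)\<^sup>2" using \<open>0 < c1\<close> by auto
    then have "(p r)\<^sup>2 \<le> 4 * F r" using low[OF r] by simp
    from sq[OF this _ r] have "\<bar>p r\<bar> \<le> sqrt (4 * D) * r powr (- (c / 2))" by auto
    also have "\<dots> \<le> C * r powr (- (c / 2))" by (intro mult_right_mono) (auto simp: C_def)
    finally show "\<bar>p r\<bar> \<le> C * r powr (- (c / 2))" .
  qed (use c in auto)
qed

subsection \<open>Local existence\<close>

text \<open>The interval starts at the initial time and the derivative is one-sided there, because
  the solution is only to be continued to the right.\<close>

lemma picard_local_existence:
  fixes f :: "real \<Rightarrow> 'a::banach \<Rightarrow> 'a"
  assumes "a < b" "e > 0"
    and cont: "continuous_on ({a..b} \<times> cball x0 e) (\<lambda>(t, x). f t x)"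
    and lip: "\<And>t. t \<in> {a..b} \<Longrightarrow> L-lipschitz_on (cball x0 e) (f t)"
    and bound: "\<And>t x. t \<in> {a..b} \<Longrightarrow> x \<in> cball x0 e \<Longrightarrow> norm (f t x) \<le> B"
  obtains c \<phi> where "a < c" "c \<le> b" "\<phi> a = x0"
    "\<And>t. t \<in> {a..c} \<Longrightarrow> \<phi> t \<in> cball x0 e"
    "\<And>t. t \<in> {a..c} \<Longrightarrow> (\<phi> has_vector_derivative f t (\<phi> t)) (at t within {a..c})"
proof -
  have "B \<ge> 0" using bound[of a x0] assms(1,2) by (auto intro: order_trans[OF norm_ge_zero])
  have "L \<ge> 0" using lip[of a] assms(1) by (auto simp: lipschitz_on_def)
  \<comment> \<open>The three bounds on the length keep \<open>t\<close> in \<open>{a..b}\<close>,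
    the iterates in the ball, and the contraction factor at most 1/2; the added ones avoid division
    by zero.\<close>
  define c where "c = a + min (b - a) (min (e / (B + 1)) (1 / (2 * (L + 1))))"
  have c: "a < c" "c \<le> b"
    using assms \<open>B \<ge> 0\<close> \<open>L \<ge> 0\<close> by (auto simp: c_def)
  have "B * (c - a) \<le> B * (e / (B + 1))"
    using \<open>B \<ge> 0\<close> by (intro mult_left_mono) (auto simp: c_def)
  also have "\<dots> \<le> e" using \<open>B \<ge> 0\<close> \<open>e > 0\<close> by (simp add: field_simps)
  finally have ce: "B * (c - a) \<le> e" .
  have "L * (c - a) \<le> L * (1 / (2 * (L + 1)))"
    using \<open>L \<ge> 0\<close> by (intro mult_left_mono) (auto simp: c_def)
  also have "\<dots> \<le> 1/2" using \<open>L \<ge> 0\<close> by (simp add: field_simps)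
  finally have cL: "L * (c - a) \<le> 1/2" .
  define S :: "(real \<Rightarrow>\<^sub>C 'a) set" where "S = PiC UNIV (\<lambda>_. cball x0 e)"
  have S: "\<phi> \<in> S \<longleftrightarrow> (\<forall>t. apply_bcontfun \<phi> t \<in> cball x0 e)" for \<phi>
    by (auto simp: S_def mem_PiC_iff)
  define I where "I = (\<lambda>(\<phi> :: real \<Rightarrow>\<^sub>C 'a) t. x0 + integral {a..t} (\<lambda>s. f s (\<phi> s)))"
  have fc: "continuous_on {a..c} (\<lambda>s. f s (apply_bcontfun \<phi> s))" if "\<phi> \<in> S" for \<phi>
  proof -
    have "continuous_on {a..c} ((\<lambda>(t, x). f t x) \<circ> (\<lambda>s. (s, apply_bcontfun \<phi> s)))"
      using that c by (intro continuous_on_compose continuous_intros continuous_on_subset[OF cont])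
        (auto simp: S)
    then show ?thesis by (simp add: o_def)
  qed
  have Id: "(I \<phi> has_vector_derivative f t (apply_bcontfun \<phi> t)) (at t within {a..c})"
    if "\<phi> \<in> S" "t \<in> {a..c}" for \<phi> t
    unfolding I_def
    using integral_has_vector_derivative[OF fc[OF that(1)] that(2)]
    by (auto intro!: derivative_eq_intros)
  have Ic: "continuous_on (cbox a c) (I \<phi>)" if "\<phi> \<in> S" for \<phi>
    using has_vector_derivative_continuous[OF Id[OF that]]
    by (auto simp: continuous_on_eq_continuous_within)
  \<comment> \<open>The fixed point is sought among bounded continuous functions on the whole line;
    \<open>clamp\<close> extends the integral, meaningful on \<open>{a..c}\<close>, by its endpoint
    values.\<close>
  have "\<exists>h :: real \<Rightarrow>\<^sub>C 'a. \<forall>t. apply_bcontfun h t = I \<phi> (clamp a c t)" if "\<phi> \<in> S" for \<phi>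
    using continuous_on_cbox_bcontfunE[OF Ic[OF that]] by metis
  then obtain T :: "(real \<Rightarrow>\<^sub>C 'a) \<Rightarrow> (real \<Rightarrow>\<^sub>C 'a)"
    where T: "\<And>\<phi> t. \<phi> \<in> S \<Longrightarrow> apply_bcontfun (T \<phi>) t = I \<phi> (clamp a c t)"
    by metis
  have cl: "clamp a c t \<in> {a..c}" for t
    using clamp_in_interval[of a c t] c by auto
  have "T ` S \<subseteq> S"
  proof (rule image_subsetI, unfold S[of "T _"], rule allI)
    fix \<phi> t assume \<phi>: "\<phi> \<in> S"
    let ?t = "clamp a c t"
    have "norm (integral {a..?t} (\<lambda>s. f s (apply_bcontfun \<phi> s))) \<le> B * (?t - a)"
      using cl[of t] c \<phi> by (intro integral_bound continuous_on_subset[OF fc[OF \<phi>]] bound) (auto simp: S)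
    also have "\<dots> \<le> B * (c - a)" using cl[of t] \<open>B \<ge> 0\<close> by (intro mult_left_mono) auto
    finally show "apply_bcontfun (T \<phi>) t \<in> cball x0 e"
      using ce by (simp add: T[OF \<phi>] I_def dist_norm)
  qed
  moreover have "dist (T \<phi>) (T \<psi>) \<le> 1/2 * dist \<phi> \<psi>" if \<phi>: "\<phi> \<in> S" and \<psi>: "\<psi> \<in> S" for \<phi> \<psi>
  proof (rule dist_bound)
    fix t
    let ?t = "clamp a c t"
    let ?f = "\<lambda>\<phi> s. f s (apply_bcontfun \<phi> s)"
    have i: "?f \<phi> integrable_on {a..?t}" if "\<phi> \<in> S" for \<phi>
      using cl[of t] by (intro integrable_continuous_real continuous_on_subset[OF fc[OF that]]) auto
    have "norm (integral {a..?t} (\<lambda>s. ?f \<phi> s - ?f \<psi> s)) \<le> (L * dist \<phi> \<psi>) * (?t - a)"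
    proof (rule integral_bound)
      fix s assume "s \<in> {a..?t}"
      then have "s \<in> {a..b}" using cl[of t] c by auto
      then have "norm (?f \<phi> s - ?f \<psi> s) \<le> L * dist (apply_bcontfun \<phi> s) (apply_bcontfun \<psi> s)"
        using \<phi> \<psi> lipschitz_onD[OF lip] by (auto simp: S dist_norm)
      also have "\<dots> \<le> L * dist \<phi> \<psi>"
        using \<open>L \<ge> 0\<close> by (intro mult_left_mono dist_bounded) auto
      finally show "norm (?f \<phi> s - ?f \<psi> s) \<le> L * dist \<phi> \<psi>" .
    qed (use cl[of t] in \<open>auto intro!: continuous_intros continuous_on_subset[OF fc] \<phi> \<psi>\<close>)
    also have "\<dots> \<le> (L * dist \<phi> \<psi>) * (c - a)"
      using cl[of t] \<open>L \<ge> 0\<close> by (intro mult_left_mono) auto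
    also have "\<dots> \<le> 1/2 * dist \<phi> \<psi>"
      using mult_right_mono[OF cL, of "dist \<phi> \<psi>"] by (simp add: algebra_simps)
    finally show "dist (apply_bcontfun (T \<phi>) t) (apply_bcontfun (T \<psi>) t) \<le> 1/2 * dist \<phi> \<psi>"
      using integral_diff[OF i[OF \<phi>] i[OF \<psi>]] by (simp add: T \<phi> \<psi> I_def dist_norm)
  qed
  moreover have "complete S"
    unfolding S_def complete_eq_closed by (intro closed_PiC) auto
  moreover have "const_bcontfun x0 \<in> S"
    using \<open>e > 0\<close> by (auto simp: S const_bcontfun.rep_eq)
  ultimately obtain \<phi> where \<phi>: "\<phi> \<in> S" "T \<phi> = \<phi>"
    using Banach_fix[of S "1/2" T] by auto
  have eq: "apply_bcontfun \<phi> t = I \<phi> t" if "t \<in> {a..c}" for t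
    using T[OF \<phi>(1), of t] \<phi>(2) that clamp_cancel_cbox[of t a c] by auto
  show thesis
  proof (rule that[of c "apply_bcontfun \<phi>"])
    show "apply_bcontfun \<phi> a = x0" using eq[of a] c by (simp add: I_def)
    show "(apply_bcontfun \<phi> has_vector_derivative f t (apply_bcontfun \<phi> t)) (at t within {a..c})"
      if t: "t \<in> {a..c}" for t
      using Id[OF \<phi>(1) t] eq t by (rule_tac has_vector_derivative_transform) auto
  qed (use c \<phi>(1) in \<open>auto simp: S\<close>)
qed

text \<open>The fundamental theorem tolerates one exceptional point, so \<open>F\<close> is an
  indefinite integral of the continuous \<open>G\<close> across \<open>z\<close>. This gives the
  equation at the point where two solutions are glued.\<close>

lemma has_derivative_at_exceptional_point:
  fixes F G :: "real \<Rightarrow> real"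
  assumes z: "a < z" "z < b"
    and F: "continuous_on {a..b} F" and G: "continuous_on {a..b} G"
    and der: "\<And>s. s \<in> {a<..<b} - {z} \<Longrightarrow> (F has_real_derivative G s) (at s)"
  shows "(F has_real_derivative G z) (at z)"
proof -
  have eq: "F s = F a + integral {a..s} G" if s: "s \<in> {a..b}" for s
  proof -
    have "(G has_integral (F s - F a)) {a..s}"
    proof (rule fundamental_theorem_of_calculus_interior_strong[of "{z}"])
      show "(F has_vector_derivative G t) (at t)" if "t \<in> {a<..<s} - {z}" for t
        using der[of t] that s by (auto simp: has_real_derivative_iff_has_vector_derivative)
      show "continuous_on {a..s} F" by (rule continuous_on_subset[OF F]) (use s in auto)
    qed (use s in auto)
    then show ?thesis by (simp add: integral_unique)
  qed
  have "((\<lambda>s. F a + integral {a..s} G) has_real_derivative G z) (at z within {a..b})"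
    using integral_has_real_derivative[OF G, of z] z by (auto intro!: derivative_eq_intros)
  then have "(F has_real_derivative G z) (at z within {a..b})"
    by (rule has_field_derivative_transform_within[where d = 1]) (use z in \<open>auto intro!: eq[symmetric]\<close>)
  then show ?thesis using z at_within_interior[of z "{a..b}"] by auto
qed

text \<open>With \<open>u\<close> standing for \<open>\<rho> powr \<gamma>\<close> and the mass as a
  second unknown, the integro-differential equation becomes a planar first order system, regular
  away from the centre and from u = 0.\<close>

lemma lane_emden_local_existence:
  fixes d :: nat and \<gamma> r0 u0 m0 :: real
  assumes \<gamma>: "0 < \<gamma>" and r0: "0 < r0" and u0: "0 < u0"
  obtains c u M where "r0 < c" "u r0 = u0" "M r0 = m0"
    "\<And>t. t \<in> {r0..c} \<Longrightarrow> 0 < u t"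
    "\<And>t. t \<in> {r0..c} \<Longrightarrow>
      (u has_real_derivative - (u t powr (1 / \<gamma>) * M t / t ^ (d - 1))) (at t within {r0..c})"
    "\<And>t. t \<in> {r0..c} \<Longrightarrow>
      (M has_real_derivative 4 * pi * (t ^ (d - 1) * u t powr (1 / \<gamma>))) (at t within {r0..c})"
proof -
  define s where "s = 1 / \<gamma>"
  have s: "0 < s" using \<gamma> by (simp add: s_def)
  define f :: "real \<Rightarrow> real \<times> real \<Rightarrow> real \<times> real" where
    "f t x = (- (fst x powr s * snd x / t ^ (d - 1)), 4 * pi * (t ^ (d - 1) * fst x powr s))" for t x
  \<comment> \<open>A ball of this radius keeps the first component at least \<open>u0 / 2\<close>,
    away from 0, where \<open>u powr (1 / \<gamma>)\<close> need not be Lipschitz.\<close>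
  define e where "e = u0 / 2"
  have e: "0 < e" using u0 by (simp add: e_def)
  \<comment> \<open>\<open>N\<close> bounds the mass and \<open>U\<close> the density on the ball;
    \<open>q\<close> and \<open>Q\<close> bound \<open>t ^ (d - 1)\<close> on
    \<open>{r0..r0 + 1}\<close>.\<close>
  define N where "N = \<bar>m0\<bar> + e"
  define U where "U = (u0 + e) powr s"
  define q where "q = r0 ^ (d - 1)"
  define Q where "Q = (r0 + 1) ^ (d - 1)"
  have pos: "0 < N" "0 \<le> U" "0 < q" "0 < Q" using e r0 by (auto simp: N_def U_def q_def Q_def)
  obtain lo hi where lh: "0 < lo" "0 < hi" "\<And>x y. x \<in> {e..u0 + e} \<Longrightarrow> y \<in> {e..u0 + e} \<Longrightarrow>
       \<exists>k\<in>{lo..hi}. x powr s - y powr s = s * k * (x - y)"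
    using powr_diff_bounds[of e "u0 + e" s] e u0 by auto
  define H where "H = s * hi"
  have H: "0 < H" using s lh by (simp add: H_def)
  have powr_lip: "\<bar>x powr s - y powr s\<bar> \<le> H * \<bar>x - y\<bar>" if xy: "x \<in> {e..u0 + e}" "y \<in> {e..u0 + e}" for x y
  proof -
    obtain k where k: "k \<in> {lo..hi}" "x powr s - y powr s = s * k * (x - y)"
      using lh(3)[OF xy] by blast
    then have "\<bar>x powr s - y powr s\<bar> = s * k * \<bar>x - y\<bar>" using s lh by (simp add: abs_mult)
    also have "\<dots> \<le> H * \<bar>x - y\<bar>" using k s unfolding H_def by (intro mult_right_mono) auto
    finally show ?thesis .
  qed
  have box: "fst x \<in> {e..u0 + e}" "\<bar>snd x\<bar> \<le> N" "0 \<le> fst x powr s" "fst x powr s \<le> U"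
    if x: "x \<in> cball (u0, m0) e" for x
  proof -
    have "dist u0 (fst x) \<le> e" "dist m0 (snd x) \<le> e"
      using x dist_fst_le[of "(u0, m0)" x] dist_snd_le[of "(u0, m0)" x] by auto
    then have "\<bar>u0 - fst x\<bar> \<le> e" "\<bar>m0 - snd x\<bar> \<le> e" by (simp_all add: dist_real_def)
    then show *: "fst x \<in> {e..u0 + e}" "\<bar>snd x\<bar> \<le> N" unfolding N_def e_def atLeastAtMost_iff by linarith+
    show "0 \<le> fst x powr s" by simp
    show "fst x powr s \<le> U" using * e s unfolding U_def by (intro powr_mono2) auto
  qed
  have norm_le: "norm v \<le> norm (fst v) + norm (snd v)" for v :: "real \<times> real"
    using norm_Pair_le[of "fst v" "snd v"] by simp
  have t: "q \<le> t ^ (d - 1)" "t ^ (d - 1) \<le> Q" if "t \<in> {r0..r0 + 1}" for t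
    using that r0 by (auto simp: q_def Q_def intro!: power_mono)
  have "continuous_on ({r0..r0 + 1} \<times> cball (u0, m0) e) (\<lambda>(t, x). f t x)"
    unfolding f_def case_prod_beta
    using box(1) e r0 by (intro continuous_intros) fastforce+
  moreover have "((H * N + U) / q + 4 * pi * Q * H)-lipschitz_on (cball (u0, m0) e) (f r)"
    if r: "r \<in> {r0..r0 + 1}" for r
  proof (rule lipschitz_onI)
    fix x y assume x: "x \<in> cball (u0, m0) e" and y: "y \<in> cball (u0, m0) e"
    let ?D = "dist x y"
    have D: "\<bar>fst x - fst y\<bar> \<le> ?D" "\<bar>snd x - snd y\<bar> \<le> ?D"
      using dist_fst_le[of x y] dist_snd_le[of x y] by (simp_all add: dist_real_def)
    have pl: "\<bar>fst x powr s - fst y powr s\<bar> \<le> H * ?D"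
      using powr_lip[OF box(1)[OF x] box(1)[OF y]] mult_left_mono[OF D(1), of H] H by linarith
    have "\<bar>fst x powr s * snd x - fst y powr s * snd y\<bar> =
        \<bar>(fst x powr s - fst y powr s) * snd x + fst y powr s * (snd x - snd y)\<bar>"
      by (simp add: algebra_simps)
    also have "\<dots> \<le> \<bar>fst x powr s - fst y powr s\<bar> * \<bar>snd x\<bar> + fst y powr s * \<bar>snd x - snd y\<bar>"
      by (rule order_trans[OF abs_triangle_ineq]) (simp add: abs_mult)
    also have "\<dots> \<le> (H * ?D) * N + U * ?D"
      using pl box[OF x] box[OF y] D pos H by (intro add_mono mult_mono) auto
    finally have "\<bar>fst x powr s * snd x - fst y powr s * snd y\<bar> \<le> (H * N + U) * ?D"
      by (simp add: algebra_simps)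
    then have "\<bar>fst x powr s * snd x - fst y powr s * snd y\<bar> / r ^ (d - 1) \<le> (H * N + U) * ?D / q"
      using t[OF r] pos H by (intro frac_le) auto
    moreover have "\<bar>fst x powr s * snd x / r ^ (d - 1) - fst y powr s * snd y / r ^ (d - 1)\<bar> =
        \<bar>fst x powr s * snd x - fst y powr s * snd y\<bar> / r ^ (d - 1)"
      using t[OF r] pos by (simp flip: diff_divide_distrib)
    ultimately have 1: "norm (fst (f r x) - fst (f r y)) \<le> (H * N + U) / q * ?D"
      by (simp add: f_def abs_minus_commute)
    have "r ^ (d - 1) * \<bar>fst x powr s - fst y powr s\<bar> \<le> Q * (H * ?D)"
      using t[OF r] pl pos by (intro mult_mono) auto
    moreover have "norm (snd (f r x) - snd (f r y)) = 4 * pi * (r ^ (d - 1) * \<bar>fst x powr s - fst y powr s\<bar>)"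
      using t[OF r] pos by (simp add: f_def abs_mult flip: right_diff_distrib)
    ultimately have 2: "norm (snd (f r x) - snd (f r y)) \<le> 4 * pi * Q * H * ?D"
      by (simp add: mult_ac)
    have "dist (f r x) (f r y) \<le> norm (fst (f r x) - fst (f r y)) + norm (snd (f r x) - snd (f r y))"
      using norm_le[of "f r x - f r y"] by (simp add: dist_norm)
    then show "dist (f r x) (f r y) \<le> ((H * N + U) / q + 4 * pi * Q * H) * ?D"
      using 1 2 by (simp add: distrib_right)
  qed (use pos H in auto)
  moreover have "norm (f r x) \<le> U * N / q + 4 * pi * (Q * U)"
    if r: "r \<in> {r0..r0 + 1}" and x: "x \<in> cball (u0, m0) e" for r x
  proof -
    have "norm (fst (f r x)) \<le> U * N / q"
    proof -
      have "fst x powr s * \<bar>snd x\<bar> / r ^ (d - 1) \<le> U * N / q"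
        using t[OF r] box[OF x] pos by (intro frac_le mult_mono) auto
      then show ?thesis using t[OF r] pos by (simp add: f_def abs_mult)
    qed
    moreover have "norm (snd (f r x)) \<le> 4 * pi * (Q * U)"
    proof -
      have "r ^ (d - 1) * fst x powr s \<le> Q * U"
        using t[OF r] box[OF x] pos by (intro mult_mono) auto
      then show ?thesis using t[OF r] pos by (simp add: f_def abs_mult)
    qed
    ultimately show ?thesis
      using norm_le[of "f r x"] by linarith
  qed
  ultimately obtain c \<phi> where c: "r0 < c" "c \<le> r0 + 1" "\<phi> r0 = (u0, m0)"
    "\<And>t. t \<in> {r0..c} \<Longrightarrow> \<phi> t \<in> cball (u0, m0) e"
    "\<And>t. t \<in> {r0..c} \<Longrightarrow> (\<phi> has_vector_derivative f t (\<phi> t)) (at t within {r0..c})"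
    using picard_local_existence[of r0 "r0 + 1" e "(u0, m0)" f] e by (metis less_add_one)
  show thesis
  proof (rule that[of c "\<lambda>t. fst (\<phi> t)" "\<lambda>t. snd (\<phi> t)"])
    fix t assume t: "t \<in> {r0..c}"
    show "0 < fst (\<phi> t)" using box(1)[OF c(4)[OF t]] e by auto
    have "((\<lambda>t. fst (\<phi> t)) has_vector_derivative fst (f t (\<phi> t))) (at t within {r0..c})"
      by (rule bounded_linear.has_vector_derivative[OF bounded_linear_fst c(5)[OF t]])
    then show "((\<lambda>t. fst (\<phi> t)) has_real_derivative
        - (fst (\<phi> t) powr (1 / \<gamma>) * snd (\<phi> t) / t ^ (d - 1))) (at t within {r0..c})"
      by (simp add: f_def s_def has_real_derivative_iff_has_vector_derivative)
    have "((\<lambda>t. snd (\<phi> t)) has_vector_derivative snd (f t (\<phi> t))) (at t within {r0..c})"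
      by (rule bounded_linear.has_vector_derivative[OF bounded_linear_snd c(5)[OF t]])
    then show "((\<lambda>t. snd (\<phi> t)) has_real_derivative
        4 * pi * (t ^ (d - 1) * fst (\<phi> t) powr (1 / \<gamma>))) (at t within {r0..c})"
      by (simp add: f_def s_def has_real_derivative_iff_has_vector_derivative)
  qed (use c in auto)
qed


subsection \<open>Scale-invariant variables\<close>

text \<open>Any solution on a possibly finite interval, not only the maximal one: trapping must be
  available before the interval is known to be infinite.\<close>

locale lane_emden =
  fixes d :: nat and \<gamma> \<rho>0 :: real and \<rho> :: "real \<Rightarrow> real" and R :: ereal
  assumes d: "3 \<le> d" and \<gamma>1: "1 \<le> \<gamma>" and \<gamma>2: "\<gamma> < 2 * real d / (real d + 2)"
    and sol: "LE_solution d \<gamma> \<rho>0 \<rho> R"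
begin

abbreviation m :: "real \<Rightarrow> real" where "m \<equiv> LE_mass d \<rho>"

text \<open>The scaling exponent: the equation is invariant under replacing \<rho>(r) by
  \<open>\<lambda> powr \<alpha> * \<rho> (\<lambda> * r)\<close>.\<close>

definition \<alpha> :: real where "\<alpha> = 2 / (2 - \<gamma>)"
definition \<delta> :: real where "\<delta> = real d - \<alpha> * \<gamma>"
text \<open>In the variable \<open>ln r\<close>, the scale-invariant quantities \<open>X\<close> and \<open>Y\<close> satisfy an autonomous
  system, and \<open>P\<close> is the logarithmic derivative \<open>r * X'\<close> divided by \<open>X powr (2 - \<gamma>)\<close>.\<close>

definition X :: "real \<Rightarrow> real" where "X r = r powr \<alpha> * \<rho> r"
definition Y :: "real \<Rightarrow> real" where "Y r = r powr (\<alpha> - real d) * m r"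
definition P :: "real \<Rightarrow> real" where "P r = \<alpha> * X r powr (\<gamma> - 1) - Y r / \<gamma>"
definition g :: "real \<Rightarrow> real" where
  "g x = 4 * pi / \<gamma> * x - \<alpha> * (real d - \<alpha>) * x powr (\<gamma> - 1)"

lemma \<gamma>_lt_2: "\<gamma> < 2"
proof -
  have "2 * real d / (real d + 2) < 2" by (simp add: field_simps)
  then show ?thesis using \<gamma>2 by linarith
qed

lemma \<alpha>_eq: "\<alpha> * (2 - \<gamma>) = 2"
  using \<alpha>_def[unfolded eq_divide_eq] \<gamma>_lt_2 by simp

lemma \<alpha>_pos: "0 < \<alpha>"
  using \<gamma>_lt_2 by (simp add: \<alpha>_def)

lemma \<delta>_pos: "0 < \<delta>"
proof -
  have "\<gamma> * (real d + 2) < 2 * real d" using \<gamma>2 by (simp add: field_simps)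
  then have "2 * \<gamma> < real d * (2 - \<gamma>)" by (simp add: algebra_simps)
  then show ?thesis using \<gamma>_lt_2 by (simp add: \<delta>_def \<alpha>_def field_simps)
qed

lemma \<alpha>_lt_d: "\<alpha> < real d"
  using \<delta>_pos mult_left_mono[OF \<gamma>1, of \<alpha>] \<alpha>_pos unfolding \<delta>_def by linarith

lemma R_pos: "0 < R" and cont: "continuous_on {r. 0 \<le> r \<and> ereal r < R} \<rho>"
  and \<rho>_pos: "\<And>r. 0 \<le> r \<Longrightarrow> ereal r < R \<Longrightarrow> 0 < \<rho> r"
  and deriv_\<rho>_powr: "\<And>r. 0 < r \<Longrightarrow> ereal r < R \<Longrightarrow>
    ((\<lambda>s. \<rho> s powr \<gamma>) has_real_derivative (- \<rho> r * m r / r ^ (d - 1))) (at r)"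
  using sol by (auto simp: LE_solution_def)

lemma less_R: "s \<le> r \<Longrightarrow> ereal r < R \<Longrightarrow> ereal s < R"
  by (rule le_less_trans[of _ "ereal r"]) auto

lemma cont_Icc: "ereal r < R \<Longrightarrow> continuous_on {0..r} \<rho>"
  by (rule continuous_on_subset[OF cont]) (auto simp: less_R)

lemma obtain_between:
  assumes "ereal r < R"
  obtains r' where "r < r'" "ereal r' < R"
  using ereal_dense2[OF assms] by auto

lemma m_nonneg:
  assumes "0 \<le> r" "ereal r < R"
  shows "0 \<le> m r"
proof -
  have "0 \<le> \<rho> y" if "y \<in> {0..r}" for y
    using that \<rho>_pos[of y] less_R[of y r] assms by (auto simp: less_imp_le)
  moreover have "(\<lambda>y. y ^ (d - 1) * \<rho> y) integrable_on {0..r}"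
    by (intro integrable_continuous_real continuous_intros cont_Icc assms)
  ultimately have "0 \<le> integral {0..r} (\<lambda>y. y ^ (d - 1) * \<rho> y)"
    by (intro integral_nonneg) auto
  then show ?thesis by (simp add: LE_mass_def)
qed

text \<open>Integrand bound times length; this loses a factor 1/d against integrating
  \<open>y ^ (d - 1)\<close>, but keeps the power r^d.\<close>

lemma m_le:
  assumes r: "0 \<le> r" "ereal r < R" and M: "\<And>s. s \<in> {0..r} \<Longrightarrow> \<rho> s \<le> M"
  shows "m r \<le> 4 * pi * M * r ^ d"
proof -
  have "norm (y ^ (d - 1) * \<rho> y) \<le> r ^ (d - 1) * M" if "y \<in> {0..r}" for y
    using that M[OF that] \<rho>_pos[of y] less_R[of y r] assms
    by (auto intro!: mult_mono power_mono simp: abs_mult)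
  then have "norm (integral {0..r} (\<lambda>y. y ^ (d - 1) * \<rho> y)) \<le> r ^ (d - 1) * M * (r - 0)"
    using r by (intro integral_bound continuous_intros cont_Icc) auto
  then have "integral {0..r} (\<lambda>y. y ^ (d - 1) * \<rho> y) \<le> M * r ^ d"
    using d by (cases d) (auto simp: algebra_simps)
  then show ?thesis by (simp add: LE_mass_def)
qed

lemma deriv_m:
  assumes "0 < r" "ereal r < R"
  shows "(m has_real_derivative 4 * pi * (r ^ (d - 1) * \<rho> r)) (at r)"
proof -
  obtain r' where r': "r < r'" "ereal r' < R" using obtain_between assms by blast
  have "((\<lambda>x. integral {0..x} (\<lambda>y. y ^ (d - 1) * \<rho> y)) has_real_derivative r ^ (d - 1) * \<rho> r)
      (at r within {0..r'})"
    using r' assms by (intro integral_has_real_derivative continuous_intros cont_Icc) auto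
  moreover have "at r within {0..r'} = at r"
    using r' assms by (intro at_within_interior) auto
  ultimately show ?thesis unfolding LE_mass_def by (auto intro!: derivative_eq_intros)
qed

text \<open>Differentiability is given for \<open>\<rho> powr \<gamma>\<close> only; it passes to
  \<rho> through the power 1/\<gamma>, which is smooth at positive values.\<close>

lemma deriv_\<rho>:
  assumes r: "0 < r" "ereal r < R"
  shows "(\<rho> has_real_derivative - (\<rho> r powr (2 - \<gamma>) * m r / r ^ (d - 1) / \<gamma>)) (at r)"
proof -
  have pos: "0 < \<rho> r" using \<rho>_pos r by simp
  obtain r' where r': "r < r'" "ereal r' < R" using obtain_between r by blast
  have "((\<lambda>s. (\<rho> s powr \<gamma>) powr (1 / \<gamma>)) has_real_derivative
      (1 / \<gamma>) * (\<rho> r powr \<gamma>) powr (1 / \<gamma> - 1) * (- \<rho> r * m r / r ^ (d - 1))) (at r)"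
    using DERIV_chain2[OF has_real_derivative_powr deriv_\<rho>_powr[OF r], of "1 / \<gamma>"] pos by simp
  moreover have "(1 / \<gamma>) * (\<rho> r powr \<gamma>) powr (1 / \<gamma> - 1) * (- \<rho> r * m r / r ^ (d - 1)) =
      - (\<rho> r powr (2 - \<gamma>) * m r / r ^ (d - 1) / \<gamma>)"
  proof -
    have "(\<rho> r powr \<gamma>) powr (1 / \<gamma> - 1) = \<rho> r powr (1 - \<gamma>)"
      using \<gamma>1 by (simp add: powr_powr algebra_simps)
    moreover have "\<rho> r powr (1 - \<gamma>) * \<rho> r = \<rho> r powr (2 - \<gamma>)"
      using pos powr_add[of "\<rho> r" "1 - \<gamma>" 1] by simp
    ultimately show ?thesis by (simp flip: \<open>\<rho> r powr (1 - \<gamma>) * \<rho> r = _\<close> add: mult_ac)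
  qed
  ultimately have "((\<lambda>s. (\<rho> s powr \<gamma>) powr (1 / \<gamma>)) has_real_derivative
      - (\<rho> r powr (2 - \<gamma>) * m r / r ^ (d - 1) / \<gamma>)) (at r)" by simp
  then show ?thesis
  proof (rule has_field_derivative_transform_within_open[of _ _ _ "{0<..<r'}"])
    fix s assume "s \<in> {0<..<r'}"
    then have "0 < \<rho> s" using \<rho>_pos[of s] less_R[of s r'] r' by auto
    then show "(\<rho> s powr \<gamma>) powr (1 / \<gamma>) = \<rho> s" using \<gamma>1 by (simp add: powr_powr)
  qed (use r r' in auto)
qed

lemma X_pos: "0 < r \<Longrightarrow> ereal r < R \<Longrightarrow> 0 < X r"
  using \<rho>_pos by (simp add: X_def)

lemma pow_d1: "0 < r \<Longrightarrow> r ^ (d - 1) = r powr (real d - 1)"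
  using d by (simp add: of_nat_diff flip: powr_realpow)

lemma X_powr:
  assumes "0 < r" "ereal r < R"
  shows "X r powr (2 - \<gamma>) = r\<^sup>2 * \<rho> r powr (2 - \<gamma>)"
proof -
  have "X r powr (2 - \<gamma>) = r powr (\<alpha> * (2 - \<gamma>)) * \<rho> r powr (2 - \<gamma>)"
    using assms \<rho>_pos[of r] by (simp add: X_def powr_mult powr_powr)
  then show ?thesis using assms by (simp add: \<alpha>_eq)
qed

lemma deriv_X:
  assumes r: "0 < r" "ereal r < R"
  shows "(X has_real_derivative X r powr (2 - \<gamma>) * P r / r) (at r)"
proof -
  have "(X has_real_derivative \<alpha> * r powr (\<alpha> - 1) * \<rho> r +
      - (\<rho> r powr (2 - \<gamma>) * m r / r ^ (d - 1) / \<gamma>) * r powr \<alpha>) (at r)"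
    unfolding X_def
    using DERIV_mult[OF has_real_derivative_powr[OF r(1), of \<alpha>] deriv_\<rho>[OF r]] by simp
  moreover have "X r powr (2 - \<gamma>) * P r / r = \<alpha> * r powr (\<alpha> - 1) * \<rho> r +
      - (\<rho> r powr (2 - \<gamma>) * m r / r ^ (d - 1) / \<gamma>) * r powr \<alpha>"
  proof -
    have "X r powr (2 - \<gamma>) * X r powr (\<gamma> - 1) = X r"
      using X_pos[OF r] by (simp add: powr_add[symmetric])
    then have "X r powr (2 - \<gamma>) * P r = \<alpha> * X r - X r powr (2 - \<gamma>) * Y r / \<gamma>"
      by (simp add: P_def right_diff_distrib mult.left_commute)
    moreover have "X r powr (2 - \<gamma>) * Y r = r * (\<rho> r powr (2 - \<gamma>) * m r / r ^ (d - 1) * r powr \<alpha>)"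
    proof -
      have "r\<^sup>2 * r powr (\<alpha> - real d) = r * (r powr \<alpha> / r ^ (d - 1))"
        using r unfolding pow_d1[OF r(1)] by (simp add: powr_diff power2_eq_square)
      moreover have "X r powr (2 - \<gamma>) * Y r =
          (r\<^sup>2 * r powr (\<alpha> - real d)) * (\<rho> r powr (2 - \<gamma>) * m r)"
        by (simp add: X_powr[OF r] Y_def mult_ac)
      ultimately show ?thesis by simp
    qed
    moreover have "\<alpha> * r powr (\<alpha> - 1) * \<rho> r = \<alpha> * X r / r"
      using r by (simp add: X_def powr_diff)
    ultimately show ?thesis using r by (simp add: diff_divide_distrib)
  qed
  ultimately show ?thesis by simp
qed

lemma deriv_Y:
  assumes r: "0 < r" "ereal r < R"
  shows "(Y has_real_derivative ((\<alpha> - real d) * Y r + 4 * pi * X r) / r) (at r)"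
proof -
  have "(Y has_real_derivative (\<alpha> - real d) * r powr (\<alpha> - real d - 1) * m r +
      4 * pi * (r ^ (d - 1) * \<rho> r) * r powr (\<alpha> - real d)) (at r)"
    unfolding Y_def
    using DERIV_mult[OF has_real_derivative_powr[OF r(1), of "\<alpha> - real d"] deriv_m[OF r]] by simp
  moreover have "((\<alpha> - real d) * Y r + 4 * pi * X r) / r =
      (\<alpha> - real d) * r powr (\<alpha> - real d - 1) * m r +
      4 * pi * (r ^ (d - 1) * \<rho> r) * r powr (\<alpha> - real d)"
  proof -
    have "r ^ (d - 1) * r powr (\<alpha> - real d) = r powr \<alpha> / r"
      using r unfolding pow_d1[OF r(1)] by (simp add: powr_diff)
    then have "4 * pi * (r ^ (d - 1) * \<rho> r) * r powr (\<alpha> - real d) = 4 * pi * X r / r"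
      by (simp add: X_def mult_ac)
    moreover have "r powr (\<alpha> - real d - 1) = r powr (\<alpha> - real d) / r"
      using r powr_diff[of r "\<alpha> - real d" 1] by simp
    ultimately show ?thesis by (simp add: Y_def add_divide_distrib)
  qed
  ultimately show ?thesis by simp
qed

text \<open>The powers of \<open>X\<close> cancel in the derivative of
  \<open>X powr (\<gamma> - 1)\<close>, leaving (\<gamma> - 1) P. Eliminating \<open>Y\<close> then
  turns the coefficient of \<open>P\<close> into \<alpha> (\<gamma> - 1) - (d - \<alpha>) =
  -\<delta>. This constant friction is the reason for taking \<open>P\<close>, and not
  \<open>r * X'\<close>, as velocity.\<close>

lemma deriv_P:
  assumes r: "0 < r" "ereal r < R"
  shows "(P has_real_derivative (- \<delta> * P r - g (X r)) / r) (at r)"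
proof -
  have "((\<lambda>r. X r powr (\<gamma> - 1)) has_real_derivative
      (\<gamma> - 1) * X r powr (\<gamma> - 1 - 1) * (X r powr (2 - \<gamma>) * P r / r)) (at r)"
    by (rule DERIV_chain2[OF has_real_derivative_powr[OF X_pos[OF r]] deriv_X[OF r]])
  moreover have "X r powr (\<gamma> - 1 - 1) * X r powr (2 - \<gamma>) = 1"
    using X_pos[OF r] by (simp add: powr_add[symmetric])
  moreover have "k * a * (b * q / r) = k * (a * b) * q / r" for k a b q :: real
    by simp
  ultimately have "((\<lambda>r. X r powr (\<gamma> - 1)) has_real_derivative (\<gamma> - 1) * 1 * P r / r) (at r)"
    by (simp only:)
  then have "(P has_real_derivative
      \<alpha> * ((\<gamma> - 1) * 1 * P r / r) - ((\<alpha> - real d) * Y r + 4 * pi * X r) / r / \<gamma>) (at r)"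
    using DERIV_diff[OF DERIV_cmult[of _ _ _ _ \<alpha>] DERIV_cdivide[OF deriv_Y[OF r], of \<gamma>]]
    by (simp only: P_def[abs_def])
  moreover have Y: "Y r = \<gamma> * (\<alpha> * X r powr (\<gamma> - 1) - P r)"
    using \<gamma>1 by (simp add: P_def)
  have "\<alpha> * ((\<gamma> - 1) * 1 * P r / r) - ((\<alpha> - real d) * Y r + 4 * pi * X r) / r / \<gamma> =
      (- \<delta> * P r - g (X r)) / r"
    using r \<gamma>1 unfolding Y \<delta>_def g_def by (simp add: field_simps)
  ultimately show ?thesis by simp
qed

lemma deriv_energy:
  assumes r: "0 < r" "ereal r < R"
    and V: "\<And>x. 0 < x \<Longrightarrow> (V has_real_derivative g x / x powr (2 - \<gamma>)) (at x)"
  shows "((\<lambda>r. (P r)\<^sup>2 / 2 + V (X r)) has_real_derivative - \<delta> * (P r)\<^sup>2 / r) (at r)"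
proof -
  have "((\<lambda>s. V (X s)) has_real_derivative
      g (X r) / X r powr (2 - \<gamma>) * (X r powr (2 - \<gamma>) * P r / r)) (at r)"
    by (rule DERIV_chain2[OF V[OF X_pos[OF r]] deriv_X[OF r]])
  then show ?thesis using X_pos[OF r] r
    by (auto intro!: derivative_eq_intros deriv_P[OF r] simp: field_simps power2_eq_square)
qed

end

subsection \<open>Energy and trapping\<close>

lemma powr_ge_imp_ge:
  fixes x q c :: real
  assumes "0 < x" "0 < q" "0 < c" "c \<le> x powr q"
  shows "c powr (1 / q) \<le> x"
  using powr_mono2[of "1 / q" c "x powr q"] assms by (simp add: powr_powr)

lemma powr_le_imp_le:
  fixes x q c :: real
  assumes "0 < x" "0 < q" "x powr q \<le> c"
  shows "x \<le> c powr (1 / q)"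
  using powr_mono2[of "1 / q" "x powr q" c] assms by (simp add: powr_powr)

context lane_emden begin

definition B :: real where "B = \<alpha> * (real d - \<alpha>)"

lemma B_pos: "0 < B"
  using \<alpha>_pos \<alpha>_lt_d by (simp add: B_def)

text \<open>Antiderivative of \<open>g x / x powr (2 - \<gamma>)\<close>. Its second term integrates
  \<open>x powr (2 * \<gamma> - 3)\<close>, hence the logarithm exactly at \<gamma> = 1. For
  \<gamma> > 1 no constant is added, so that \<open>V\<close> tends to 0 at 0 and the sign of the
  energy carries information.\<close>

definition V :: "real \<Rightarrow> real" where
  "V x = (if \<gamma> = 1 then 4 * pi * x - B * ln x
          else 4 * pi / \<gamma>\<^sup>2 * x powr \<gamma> - B / (2 * (\<gamma> - 1)) * x powr (2 * (\<gamma> - 1)))"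

lemma V_isothermal: "\<gamma> = 1 \<Longrightarrow> V = (\<lambda>x. 4 * pi * x - B * ln x)"
  by (rule ext, subst V_def, rule if_P)

lemma V_polytropic: "\<gamma> \<noteq> 1 \<Longrightarrow>
    V = (\<lambda>x. 4 * pi / \<gamma>\<^sup>2 * x powr \<gamma> - B / (2 * (\<gamma> - 1)) * x powr (2 * (\<gamma> - 1)))"
  by (rule ext, subst V_def, rule if_not_P)

lemma deriv_V:
  assumes "0 < x"
  shows "(V has_real_derivative g x / x powr (2 - \<gamma>)) (at x)"
proof (cases "\<gamma> = 1")
  case True
  have "g x / x powr (2 - \<gamma>) = (4 * pi * x - B) / x"
    unfolding g_def B_def using True assms by simp
  moreover have "((\<lambda>x. 4 * pi * x - b * ln x) has_real_derivative (4 * pi * x - b) / x) (at x)" for b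
    using assms by (auto simp: field_simps intro!: derivative_eq_intros)
  ultimately show ?thesis unfolding V_isothermal[OF True] by simp
next
  case False
  have "g x / x powr (2 - \<gamma>) = 4 * pi / \<gamma> * (x powr 1 / x powr (2 - \<gamma>)) -
      B * (x powr (\<gamma> - 1) / x powr (2 - \<gamma>))"
    using assms by (simp add: g_def B_def diff_divide_distrib)
  also have "\<dots> = 4 * pi / \<gamma>\<^sup>2 * (\<gamma> * x powr (\<gamma> - 1)) -
      B / (2 * (\<gamma> - 1)) * (2 * (\<gamma> - 1) * x powr (2 * (\<gamma> - 1) - 1))"
  proof -
    have "x powr 1 / x powr (2 - \<gamma>) = x powr (\<gamma> - 1)"
      by (simp only: powr_diff[symmetric]) simp
    moreover have "x powr (\<gamma> - 1) / x powr (2 - \<gamma>) = x powr (2 * (\<gamma> - 1) - 1)"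
      by (simp only: powr_diff[symmetric]) (simp add: algebra_simps)
    ultimately show ?thesis using False \<gamma>1 by (simp only:) (simp add: power2_eq_square)
  qed
  finally show ?thesis
    unfolding V_polytropic[OF False]
    using DERIV_diff[OF DERIV_cmult[OF has_real_derivative_powr[OF assms]]
        DERIV_cmult[OF has_real_derivative_powr[OF assms]]]
    by (simp only:)
qed

text \<open>Dropping the positive linear term gives the lower bound. For the upper one, half of the
  linear term absorbs the logarithm through ln t \<le> t - 1 at t = 2 pi x / B.\<close>

lemma V_sublevel_isothermal:
  assumes "\<gamma> = 1" "0 < x" "V x \<le> e"
  shows "exp (- e / B) \<le> x" "x \<le> (e - B + B * ln (B / (2 * pi))) / (2 * pi)"
proof -
  have V: "4 * pi * x - B * ln x \<le> e"
    using assms(3) unfolding V_isothermal[OF assms(1)] .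
  have "0 < 4 * pi * x" using assms by simp
  then have "- e / B \<le> ln x" using V B_pos by (simp add: field_simps)
  then show "exp (- e / B) \<le> x" using assms by (simp add: ln_ge_iff)
  have "ln (2 * pi * x / B) \<le> 2 * pi * x / B - 1"
    using assms B_pos by (intro ln_le_minus_one) auto
  then have "B * ln (2 * pi * x / B) \<le> B * (2 * pi * x / B - 1)"
    using B_pos by (intro mult_left_mono) auto
  moreover have "ln (2 * pi * x / B) = ln x - ln (B / (2 * pi))"
    using assms B_pos by (simp add: ln_div ln_mult)
  ultimately have "B * ln x \<le> 2 * pi * x - B + B * ln (B / (2 * pi))"
    using B_pos by (simp add: right_diff_distrib)
  then show "x \<le> (e - B + B * ln (B / (2 * pi))) / (2 * pi)"
    using V by (simp add: field_simps)
qed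

text \<open>The lower bound drops the positive term of \<open>V\<close>. The upper bound uses only
  that \<open>V x\<close> is negative: since \<gamma> = (2 - \<gamma>) + 2 (\<gamma> - 1), the
  common factor \<open>x powr (2 * (\<gamma> - 1))\<close> cancels.\<close>

lemma V_sublevel_polytropic:
  assumes "1 < \<gamma>" "0 < x" "V x \<le> e" "e < 0"
  shows "(- e * (2 * (\<gamma> - 1)) / B) powr (1 / (2 * (\<gamma> - 1))) \<le> x"
    "x \<le> (B / (2 * (\<gamma> - 1)) * (\<gamma>\<^sup>2 / (4 * pi))) powr (1 / (2 - \<gamma>))"
proof -
  have V: "4 * pi / \<gamma>\<^sup>2 * x powr \<gamma> - B / (2 * (\<gamma> - 1)) * x powr (2 * (\<gamma> - 1)) \<le> e"
    using assms by (simp add: V_def)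
  have "0 \<le> 4 * pi / \<gamma>\<^sup>2 * x powr \<gamma>" by simp
  then have "- e \<le> B / (2 * (\<gamma> - 1)) * x powr (2 * (\<gamma> - 1))" using V by linarith
  then have "- e * (2 * (\<gamma> - 1)) / B \<le> x powr (2 * (\<gamma> - 1))"
    using B_pos assms by (simp add: field_simps)
  then show "(- e * (2 * (\<gamma> - 1)) / B) powr (1 / (2 * (\<gamma> - 1))) \<le> x"
    using assms B_pos by (intro powr_ge_imp_ge divide_pos_pos mult_pos_pos) auto
  have "4 * pi / \<gamma>\<^sup>2 * x powr \<gamma> \<le> B / (2 * (\<gamma> - 1)) * x powr (2 * (\<gamma> - 1))"
    using V assms by linarith
  moreover have "x powr \<gamma> = x powr (2 - \<gamma>) * x powr (2 * (\<gamma> - 1))"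
    by (simp flip: powr_add)
  ultimately have "(4 * pi / \<gamma>\<^sup>2 * x powr (2 - \<gamma>)) * x powr (2 * (\<gamma> - 1)) \<le>
      B / (2 * (\<gamma> - 1)) * x powr (2 * (\<gamma> - 1))"
    by simp
  then have "4 * pi / \<gamma>\<^sup>2 * x powr (2 - \<gamma>) \<le> B / (2 * (\<gamma> - 1))"
    using assms(2) by (subst (asm) mult_le_cancel_right_pos) auto
  then have "x powr (2 - \<gamma>) \<le> B / (2 * (\<gamma> - 1)) * (\<gamma>\<^sup>2 / (4 * pi))"
    using assms(1) by (simp add: field_simps)
  then show "x \<le> (B / (2 * (\<gamma> - 1)) * (\<gamma>\<^sup>2 / (4 * pi))) powr (1 / (2 - \<gamma>))"
    using assms \<gamma>_lt_2 by (intro powr_le_imp_le) auto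
qed

definition E :: "real \<Rightarrow> real" where "E r = (P r)\<^sup>2 / 2 + V (X r)"

lemma E_antimono:
  assumes "0 < s" "s \<le> r" "ereal r < R"
  shows "E r \<le> E s"
proof (rule DERIV_nonpos_imp_nonincreasing[OF assms(2)])
  fix t assume t: "s \<le> t" "t \<le> r"
  then have "(E has_real_derivative - \<delta> * (P t)\<^sup>2 / t) (at t)"
    unfolding E_def[abs_def] using assms less_R by (intro deriv_energy deriv_V) auto
  moreover have "- \<delta> * (P t)\<^sup>2 / t \<le> 0"
    using t assms \<delta>_pos by (simp add: divide_nonneg_pos)
  ultimately show "\<exists>y. (E has_real_derivative y) (at t) \<and> y \<le> 0" by blast
qed

text \<open>For \<open>\<gamma> > 1\<close> the potential \<open>V\<close> tends to \<open>0\<close> at \<open>0\<close>, so only negative energy levels keep \<open>X\<close>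
  away from \<open>0\<close>. Near the centre \<open>\<bar>P\<bar> \<le> \<alpha> * X powr (\<gamma> - 1)\<close>, and the coefficient of
  \<open>X powr (2 * (\<gamma> - 1))\<close> in the energy is at most \<open>- \<alpha> * \<delta> / (2 * (\<gamma> - 1)) < 0\<close>, up to \<open>O(r\<^sup>2)\<close>.\<close>

lemma E_neg:
  assumes "1 < \<gamma>"
  obtains r where "0 < r" "ereal r < R" "E r < 0"
proof -
  define s where "s = \<gamma> - 1"
  have s: "0 < s" using assms by (simp add: s_def)
  have \<rho>0: "0 < \<rho> 0" using \<rho>_pos[of 0] R_pos by (simp add: zero_ereal_def)
  obtain r1 where r1: "0 < r1" "ereal r1 < R" using obtain_between[of 0] R_pos by (auto simp: zero_ereal_def)
  have "continuous_on {0..r1} \<rho>" using cont_Icc r1 by blast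
  then obtain \<eta> where \<eta>: "0 < \<eta>"
    "\<And>y. y \<in> {0..r1} \<Longrightarrow> dist y 0 < \<eta> \<Longrightarrow> dist (\<rho> y) (\<rho> 0) < \<rho> 0 / 2"
    unfolding continuous_on_iff using r1 \<rho>0
    by (metis atLeastAtMost_iff half_gt_zero less_imp_le order_refl)
  \<comment> \<open>Below the first threshold for \<open>r\<^sup>2\<close>, 0 \<le> Y / \<gamma>
    \<le> \<open>2 * \<alpha> * X powr s\<close>, which bounds \<bar>P\<bar>; below the second, the
    positive term of \<open>V\<close> stays under the margin \<alpha> \<delta> / (2 s). Both allow
    \<rho> to vary by a factor 2 from its central value.\<close>
  define \<kappa> where "\<kappa> = min (2 * \<alpha> * \<gamma> * (\<rho> 0 / 2) powr s / (4 * pi * (2 * \<rho> 0)))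
      (\<alpha> * \<delta> / (2 * s) / (4 * pi / \<gamma>\<^sup>2 * (2 * \<rho> 0) powr (2 - \<gamma>)))"
  have "0 < \<kappa>"
    using \<alpha>_pos \<gamma>1 \<rho>0 \<delta>_pos s unfolding \<kappa>_def min_less_iff_conj
    by (intro conjI divide_pos_pos mult_pos_pos) auto
  define r where "r = min (min 1 (\<kappa> / 2)) (min r1 (\<eta> / 2))"
  have r: "0 < r" "r \<le> r1" "r < \<eta>" "r \<le> 1" "r \<le> \<kappa> / 2"
    using \<open>0 < \<kappa>\<close> r1 \<eta>(1) by (auto simp: r_def min_less_iff_conj min_le_iff_disj)
  have rR: "ereal r < R" using less_R r r1 by blast
  have "r\<^sup>2 \<le> r" using r by (simp add: power2_eq_square mult_left_le)
  then have r2: "r\<^sup>2 < \<kappa>" using r \<open>0 < \<kappa>\<close> by linarith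
  have \<rho>b: "\<rho> 0 / 2 \<le> \<rho> y \<and> \<rho> y \<le> 2 * \<rho> 0" if "y \<in> {0..r}" for y
  proof -
    have "\<bar>\<rho> y - \<rho> 0\<bar> < \<rho> 0 / 2" using \<eta>(2)[of y] that r by (simp add: dist_real_def)
    then show ?thesis using \<rho>0 by linarith
  qed
  have "m r \<le> 4 * pi * (2 * \<rho> 0) * r ^ d" using \<rho>b r rR by (intro m_le) auto
  then have "r powr (\<alpha> - real d) * m r \<le> r powr (\<alpha> - real d) * (4 * pi * (2 * \<rho> 0) * r powr real d)"
    using r by (intro mult_left_mono) (auto simp: powr_realpow)
  also have "\<dots> = 4 * pi * (2 * \<rho> 0) * (r powr (\<alpha> - real d) * r powr real d)" by simp
  also have "r powr (\<alpha> - real d) * r powr real d = r powr \<alpha>" by (simp flip: powr_add)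
  also have "\<dots> = r\<^sup>2 * r powr (\<alpha> * s)"
  proof -
    \<comment> \<open>The surplus 2 in the exponent makes \<open>Y\<close> smaller than
      \<open>X powr s\<close> by a factor of order \<open>r\<^sup>2\<close>.\<close>
    have "\<alpha> = 2 + \<alpha> * s" using \<alpha>_eq by (simp add: s_def algebra_simps)
    then have "r powr \<alpha> = r powr 2 * r powr (\<alpha> * s)" by (metis powr_add)
    then show ?thesis using r by simp
  qed
  finally have "Y r \<le> 4 * pi * (2 * \<rho> 0) * r\<^sup>2 * r powr (\<alpha> * s)" by (simp add: Y_def)
  also have "\<dots> \<le> (2 * \<alpha> * \<gamma> * (\<rho> 0 / 2) powr s) * r powr (\<alpha> * s)"
  proof (rule mult_right_mono)
    have "r\<^sup>2 \<le> 2 * \<alpha> * \<gamma> * (\<rho> 0 / 2) powr s / (4 * pi * (2 * \<rho> 0))"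
      using r2 by (simp add: \<kappa>_def)
    then show "4 * pi * (2 * \<rho> 0) * r\<^sup>2 \<le> 2 * \<alpha> * \<gamma> * (\<rho> 0 / 2) powr s"
      using \<rho>0 by (simp add: pos_le_divide_eq mult_ac)
  qed auto
  also have "\<dots> \<le> (2 * \<alpha> * \<gamma> * \<rho> r powr s) * r powr (\<alpha> * s)"
    using \<rho>b[of r] r \<rho>0 s \<alpha>_pos \<gamma>1 by (intro mult_right_mono mult_left_mono powr_mono2) auto
  also have "\<dots> = 2 * \<alpha> * \<gamma> * X r powr s"
    using r \<rho>_pos[of r] rR by (simp add: X_def powr_mult powr_powr)
  finally have "Y r / \<gamma> \<le> 2 * (\<alpha> * X r powr s)" using \<gamma>1 by (simp add: field_simps)
  moreover have "0 \<le> Y r / \<gamma>" using m_nonneg[of r] r rR \<gamma>1 by (simp add: Y_def)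
  ultimately have "\<bar>P r\<bar> \<le> \<alpha> * X r powr s" unfolding P_def s_def by linarith
  then have "(P r)\<^sup>2 \<le> (\<alpha> * X r powr s)\<^sup>2" using \<alpha>_pos by (intro abs_le_square_iff[THEN iffD1]) auto
  also have "\<dots> = \<alpha>\<^sup>2 * X r powr (2 * s)"
    by (simp add: power_mult_distrib power2_eq_square flip: powr_add)
  finally have P2: "(P r)\<^sup>2 / 2 \<le> \<alpha>\<^sup>2 / 2 * X r powr (2 * s)" by simp
  have "X r powr \<gamma> = X r powr (2 - \<gamma>) * X r powr (2 * s)"
    by (simp add: s_def flip: powr_add)
  then have VX: "V (X r) = (4 * pi / \<gamma>\<^sup>2 * X r powr (2 - \<gamma>) - B / (2 * s)) * X r powr (2 * s)"
    using assms by (simp add: V_def s_def left_diff_distrib)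
  have "4 * pi / \<gamma>\<^sup>2 * X r powr (2 - \<gamma>) \<le> (4 * pi / \<gamma>\<^sup>2 * (2 * \<rho> 0) powr (2 - \<gamma>)) * r\<^sup>2"
  proof -
    have "\<rho> r powr (2 - \<gamma>) \<le> (2 * \<rho> 0) powr (2 - \<gamma>)"
      using \<rho>b[of r] r \<rho>0 \<gamma>_lt_2 by (intro powr_mono2) auto
    then have "4 * pi / \<gamma>\<^sup>2 * (r\<^sup>2 * \<rho> r powr (2 - \<gamma>)) \<le> 4 * pi / \<gamma>\<^sup>2 * (r\<^sup>2 * (2 * \<rho> 0) powr (2 - \<gamma>))"
      by (intro mult_left_mono) auto
    then show ?thesis using X_powr[of r] r rR by (simp add: mult_ac)
  qed
  also have "\<dots> < \<alpha> * \<delta> / (2 * s)"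
  proof -
    have "r\<^sup>2 < \<alpha> * \<delta> / (2 * s) / (4 * pi / \<gamma>\<^sup>2 * (2 * \<rho> 0) powr (2 - \<gamma>))"
      using r2 by (simp add: \<kappa>_def)
    moreover have "0 < 4 * pi / \<gamma>\<^sup>2 * (2 * \<rho> 0) powr (2 - \<gamma>)" using \<gamma>1 \<rho>0 by simp
    ultimately show ?thesis by (simp only: pos_less_divide_eq mult_ac)
  qed
  finally have "\<alpha>\<^sup>2 / 2 + (4 * pi / \<gamma>\<^sup>2 * X r powr (2 - \<gamma>) - B / (2 * s)) <
      \<alpha>\<^sup>2 / 2 + \<alpha> * \<delta> / (2 * s) - B / (2 * s)" by simp
  \<comment> \<open>\<alpha> s + \<delta> = d - \<alpha>, and multiplying by \<alpha> gives
    \<open>\<alpha>\<^sup>2 * s + \<alpha> * \<delta> = B\<close>.\<close>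
  also have "\<dots> = 0"
    using s by (simp add: \<delta>_def B_def s_def field_simps power2_eq_square)
  finally have "(\<alpha>\<^sup>2 / 2 + (4 * pi / \<gamma>\<^sup>2 * X r powr (2 - \<gamma>) - B / (2 * s))) * X r powr (2 * s) < 0"
    using X_pos[OF r(1) rR] by (intro mult_neg_pos) auto
  then have "E r < 0" using P2 unfolding E_def VX distrib_right by linarith
  then show thesis using that r rR by blast
qed

text \<open>Since \<open>V (X r)\<close> is at most \<open>E r\<close>, \<open>X\<close> stays in a
  sublevel set of \<open>V\<close>. At \<gamma> = 1 any starting radius will do; otherwise it has to
  be one where the energy is negative.\<close>

lemma trapped:
  obtains r0 a b where "0 < r0" "ereal r0 < R" "0 < a"
    "\<And>r. r0 \<le> r \<Longrightarrow> ereal r < R \<Longrightarrow> X r \<in> {a..b}"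
proof -
  have V_le: "V (X r) \<le> E r0" if "0 < r0" "r0 \<le> r" "ereal r < R" for r r0
    using E_antimono[OF that] zero_le_power2[of "P r"] unfolding E_def[of r] by linarith
  show thesis
  proof (cases "\<gamma> = 1")
    case True
    obtain r0 where r0: "0 < r0" "ereal r0 < R"
      using obtain_between[of 0] R_pos by (auto simp: zero_ereal_def)
    show thesis
      by (rule that[OF r0, of "exp (- E r0 / B)"])
        (use V_sublevel_isothermal[OF True X_pos V_le[OF r0(1)]] r0 in auto)
  next
    case False
    then have "1 < \<gamma>" using \<gamma>1 by simp
    then obtain r0 where r0: "0 < r0" "ereal r0 < R" "E r0 < 0" using E_neg by blast
    show thesis
    proof (rule that[OF r0(1,2)])
      show "0 < (- E r0 * (2 * (\<gamma> - 1)) / B) powr (1 / (2 * (\<gamma> - 1)))"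
        using r0 B_pos \<open>1 < \<gamma>\<close> by simp
      show "X r \<in> {(- E r0 * (2 * (\<gamma> - 1)) / B) powr (1 / (2 * (\<gamma> - 1)))
          ..(B / (2 * (\<gamma> - 1)) * (\<gamma>\<^sup>2 / (4 * pi))) powr (1 / (2 - \<gamma>))}"
        if "r0 \<le> r" "ereal r < R" for r
        using V_sublevel_polytropic[OF \<open>1 < \<gamma>\<close> X_pos V_le[OF r0(1)] r0(3)] that r0 by simp
    qed
  qed
qed

end

subsection \<open>Continuation beyond a finite radius\<close>

context lane_emden begin

text \<open>On \<open>{r0..<T}\<close> trapping bounds \<rho> from above and below by positive
  constants. So \<rho>' is bounded, \<rho> is Lipschitz and extends to \<open>T\<close>, and the
  lower bound makes the limit positive.\<close>

lemma left_limit_exists: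
  assumes T: "R = ereal T"
  obtains r0 h where "0 < r0" "r0 < T" "continuous_on {r0..T} h" "0 < h T"
    "\<And>r. r0 \<le> r \<Longrightarrow> r < T \<Longrightarrow> h r = \<rho> r"
proof -
  obtain r0 a b where r0: "0 < r0" "r0 < T" and a: "0 < a"
    and tr: "\<And>r. r0 \<le> r \<Longrightarrow> r < T \<Longrightarrow> X r \<in> {a..b}"
    using trapped T by (metis less_ereal.simps(1))
  have lower: "a / T powr \<alpha> \<le> \<rho> r" and upper: "\<rho> r \<le> b / r0 powr \<alpha>" if r: "r0 \<le> r" "r < T" for r
  proof -
    have p: "0 < r0 powr \<alpha>" "r0 powr \<alpha> \<le> r powr \<alpha>" "r powr \<alpha> \<le> T powr \<alpha>"
      using r r0 \<alpha>_pos by (auto intro!: powr_mono2)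
    have \<rho>: "0 \<le> \<rho> r" using \<rho>_pos[of r] r r0 T by simp
    have X: "a \<le> r powr \<alpha> * \<rho> r" "r powr \<alpha> * \<rho> r \<le> b" using tr[OF r] by (auto simp: X_def)
    have "a \<le> T powr \<alpha> * \<rho> r" "r0 powr \<alpha> * \<rho> r \<le> b"
      using X mult_right_mono[OF p(2) \<rho>] mult_right_mono[OF p(3) \<rho>] by linarith+
    then show "a / T powr \<alpha> \<le> \<rho> r" "\<rho> r \<le> b / r0 powr \<alpha>"
      using p r r0 by (simp_all add: pos_divide_le_eq pos_le_divide_eq mult.commute)
  qed
  \<comment> \<open>The mass integrates \<rho> from the centre, so a bound is also needed on
    \<open>{0..r0}\<close>, about which trapping says nothing.\<close>
  have "compact (\<rho> ` {0..r0})" using r0 T by (intro compact_continuous_image cont_Icc) auto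
  then obtain M0 where M0: "\<And>s. s \<in> {0..r0} \<Longrightarrow> \<bar>\<rho> s\<bar> \<le> M0"
    by (metis compact_imp_bounded bounded_pos imageI real_norm_def)
  define M where "M = max M0 (b / r0 powr \<alpha>)"
  have M: "\<rho> s \<le> M" if "0 \<le> s" "s < T" for s
    using M0[of s] upper[of s] that by (cases "s \<le> r0") (auto simp: M_def le_max_iff_disj)
  have "0 < M" using M[of r0] \<rho>_pos[of r0] r0 T by auto
  define C where "C = M powr (2 - \<gamma>) * (4 * pi * M * T ^ d) / r0 ^ (d - 1) / \<gamma>"
  have "C-lipschitz_on {r0..<T} \<rho>"
  proof (rule lipschitz_onI)
    fix x y assume xy: "x \<in> {r0..<T}" "y \<in> {r0..<T}"
    have "norm (\<rho> x - \<rho> y) \<le> C * norm (x - y)"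
    proof (rule field_differentiable_bound[of "{r0..<T}"])
      fix z assume z: "z \<in> {r0..<T}"
      show "(\<rho> has_real_derivative - (\<rho> z powr (2 - \<gamma>) * m z / z ^ (d - 1) / \<gamma>)) (at z within {r0..<T})"
        using deriv_\<rho>[of z] z r0 T by (auto intro: has_field_derivative_at_within)
      have m: "0 \<le> m z" using m_nonneg[of z] z r0 T by simp
      have "m z \<le> 4 * pi * M * z ^ d" using M z r0 T by (intro m_le) auto
      also have "\<dots> \<le> 4 * pi * M * T ^ d"
        using z r0 \<open>0 < M\<close> by (intro mult_left_mono power_mono) auto
      finally have "\<rho> z powr (2 - \<gamma>) * m z / z ^ (d - 1) / \<gamma> \<le> C"
        unfolding C_def using m M[of z] z r0 \<gamma>1 \<gamma>_lt_2 \<rho>_pos[of z] T \<open>0 < M\<close>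
        by (intro divide_right_mono frac_le mult_mono powr_mono2 power_mono) auto
      moreover have "0 \<le> \<rho> z powr (2 - \<gamma>) * m z / z ^ (d - 1) / \<gamma>"
        using m z r0 \<gamma>1 by (intro divide_nonneg_nonneg mult_nonneg_nonneg) auto
      ultimately show "norm (- (\<rho> z powr (2 - \<gamma>) * m z / z ^ (d - 1) / \<gamma>)) \<le> C" by simp
    qed (use xy in auto)
    then show "dist (\<rho> x) (\<rho> y) \<le> C * dist x y" by (simp add: dist_norm)
  next
    show "0 \<le> C" using \<open>0 < M\<close> r0 \<gamma>1 by (simp add: C_def)
  qed
  then obtain h where h: "C-lipschitz_on (closure {r0..<T}) h" "\<And>x. x \<in> {r0..<T} \<Longrightarrow> h x = \<rho> x"
    using lipschitz_extend_closure by metis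
  have cl: "closure {r0..<T} = {r0..T}" using r0 by simp
  have ch: "continuous_on (closure {r0..<T}) h" by (rule lipschitz_on_continuous_on[OF h(1)])
  have "a / T powr \<alpha> \<le> h T"
    by (rule continuous_ge_on_closure[OF ch]) (use r0 cl lower h(2) in auto)
  moreover have "0 < a / T powr \<alpha>" using a r0 by simp
  ultimately show thesis using that[of r0 h] r0 ch cl h(2) by auto
qed

lemma extends_beyond:
  assumes T: "R = ereal T"
  obtains \<rho>' R' where "R < R'" "LE_solution d \<gamma> \<rho>0 \<rho>' R'"
    "\<And>r. 0 \<le> r \<Longrightarrow> ereal r < R \<Longrightarrow> \<rho>' r = \<rho> r"
proof -
  obtain r0 h where r0: "0 < r0" "r0 < T" and h: "continuous_on {r0..T} h" "0 < h T"
    "\<And>r. r0 \<le> r \<Longrightarrow> r < T \<Longrightarrow> h r = \<rho> r"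
    using left_limit_exists[OF T] by metis
  \<comment> \<open>A solution on \<open>[0, T)\<close> does not prescribe \<rho> at
    \<open>T\<close>; with the limit put there, the integrand agrees pointwise with that of the
    glued density on the closed interval.\<close>
  define m0 where "m0 = 4 * pi * integral {0..T} (\<lambda>y. y ^ (d - 1) * (if y < T then \<rho> y else h T))"
  have \<gamma>0: "0 < \<gamma>" using \<gamma>1 by simp
  have T0: "0 < T" "0 < h T powr \<gamma>" using r0 h by auto
  obtain c u N where c: "T < c" "u T = h T powr \<gamma>" "N T = m0"
    and u: "\<And>t. t \<in> {T..c} \<Longrightarrow> 0 < u t"
    and du: "\<And>t. t \<in> {T..c} \<Longrightarrow>
      (u has_real_derivative - (u t powr (1 / \<gamma>) * N t / t ^ (d - 1))) (at t within {T..c})"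
    and dN: "\<And>t. t \<in> {T..c} \<Longrightarrow>
      (N has_real_derivative 4 * pi * (t ^ (d - 1) * u t powr (1 / \<gamma>))) (at t within {T..c})"
    using lane_emden_local_existence[OF \<gamma>0 T0, of m0 d] by metis
  define \<rho>' where "\<rho>' r = (if r < T then \<rho> r else u r powr (1 / \<gamma>))" for r
  have T': "\<rho>' T = h T" using c h \<gamma>1 by (simp add: \<rho>'_def powr_powr)
  have pos: "0 < \<rho>' r" if "0 \<le> r" "r \<le> c" for r
    using that \<rho>_pos[of r] u[of r] T by (auto simp: \<rho>'_def)
  have cont': "continuous_on {0..c} \<rho>'"
  proof -
    have "continuous_on {0..r0} \<rho>'"
      using cont_Icc[of r0] r0 T by (subst continuous_on_cong[OF refl, of _ _ \<rho>]) (auto simp: \<rho>'_def)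
    moreover have "continuous_on {r0..T} \<rho>'"
    proof (subst continuous_on_cong[OF refl, of _ _ h])
      fix r assume "r \<in> {r0..T}"
      then show "\<rho>' r = h r" using T' h(3)[of r] by (cases "r = T") (auto simp: \<rho>'_def)
    qed (rule h(1))
    moreover have "continuous_on {T..c} (\<lambda>r. u r powr (1 / \<gamma>))"
    proof (intro continuous_intros)
      show "continuous_on {T..c} u" using du by (rule DERIV_continuous_on)
      show "\<forall>r\<in>{T..c}. u r \<noteq> 0" using u by (metis less_irrefl)
    qed
    then have "continuous_on {T..c} \<rho>'"
      by (subst continuous_on_cong[OF refl, of _ _ "\<lambda>r. u r powr (1 / \<gamma>)"]) (auto simp: \<rho>'_def)
    ultimately have "continuous_on (({0..r0} \<union> {r0..T}) \<union> {T..c}) \<rho>'"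
      by (intro continuous_on_closed_Un) auto
    moreover have "({0..r0} \<union> {r0..T}) \<union> {T..c} = {0..c}" using r0 c by auto
    ultimately show ?thesis by simp
  qed
  have int_cont: "continuous_on {0..c} (\<lambda>y. y ^ (d - 1) * \<rho>' y)"
    by (intro continuous_intros cont')
  have int: "(\<lambda>y. y ^ (d - 1) * \<rho>' y) integrable_on {0..r}" if "r \<le> c" for r
    by (rule integrable_continuous_real, rule continuous_on_subset[OF int_cont]) (use that in auto)
  have mass_lt: "LE_mass d \<rho>' r = m r" if "r < T" for r
    unfolding LE_mass_def using that by (intro arg_cong2[of _ _ _ _ "(*)"] integral_cong) (auto simp: \<rho>'_def)
  \<comment> \<open>Local existence treats the mass as an independent unknown. That \<open>N\<close>
    is the mass of the glued density follows by integrating its equation from \<open>T\<close>, with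
    \<open>m0\<close> accounting for the part inside \<open>T\<close>.\<close>
  have mass_ge: "LE_mass d \<rho>' r = N r" if r: "T \<le> r" "r \<le> c" for r
  proof -
    have "((\<lambda>y. 4 * pi * (y ^ (d - 1) * u y powr (1 / \<gamma>))) has_integral (N r - N T)) {T..r}"
    proof (rule fundamental_theorem_of_calculus)
      fix y assume y: "y \<in> {T..r}"
      show "(N has_vector_derivative 4 * pi * (y ^ (d - 1) * u y powr (1 / \<gamma>))) (at y within {T..r})"
        using has_field_derivative_subset[OF dN, of y "{T..r}"] y r
        by (auto simp: has_real_derivative_iff_has_vector_derivative)
    qed (use r in auto)
    then have "((\<lambda>y. 4 * pi * (y ^ (d - 1) * \<rho>' y)) has_integral (N r - N T)) {T..r}"
      by (rule has_integral_eq[rotated]) (auto simp: \<rho>'_def)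
    then have "4 * pi * integral {T..r} (\<lambda>y. y ^ (d - 1) * \<rho>' y) = N r - N T"
      by (simp add: integral_unique flip: integral_mult_right)
    moreover have "4 * pi * integral {0..T} (\<lambda>y. y ^ (d - 1) * \<rho>' y) = N T"
      unfolding c(3) m0_def using T' by (intro arg_cong2[of _ _ _ _ "(*)"] integral_cong) (auto simp: \<rho>'_def)
    moreover have "integral {0..r} (\<lambda>y. y ^ (d - 1) * \<rho>' y) =
        integral {0..T} (\<lambda>y. y ^ (d - 1) * \<rho>' y) + integral {T..r} (\<lambda>y. y ^ (d - 1) * \<rho>' y)"
      using r r0 by (intro Henstock_Kurzweil_Integration.integral_combine[symmetric] int) auto
    ultimately show ?thesis by (simp add: LE_mass_def distrib_left)
  qed
  define F where "F r = \<rho>' r powr \<gamma>" for r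
  define G where "G r = - \<rho>' r * LE_mass d \<rho>' r / r ^ (d - 1)" for r
  have dF: "(F has_real_derivative G r) (at r)" if r: "r \<in> {0<..<c} - {T}" for r
  proof (cases "r < T")
    case True
    then have "((\<lambda>s. \<rho> s powr \<gamma>) has_real_derivative G r) (at r)"
      using deriv_\<rho>_powr[of r] r T by (simp add: G_def mass_lt \<rho>'_def)
    then show ?thesis
      by (rule has_field_derivative_transform_within_open[of _ _ _ "{..<T}"])
        (use True in \<open>auto simp: F_def \<rho>'_def\<close>)
  next
    case False
    then have rc: "T < r" "r < c" using r by auto
    have "at r within {T..c} = at r" using rc by (intro at_within_interior) auto
    then have "(u has_real_derivative G r) (at r)"
      using du[of r] rc mass_ge[of r] by (simp add: G_def \<rho>'_def)
    then show ?thesis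
    proof (rule has_field_derivative_transform_within_open[of _ _ _ "{T<..<c}"])
      fix s assume "s \<in> {T<..<c}"
      then show "u s = F s" using u[of s] \<gamma>1 by (simp add: F_def \<rho>'_def powr_powr)
    qed (use rc in auto)
  qed
  \<comment> \<open>At \<open>T\<close> each piece controls one side only; both \<open>F\<close> and
    \<open>G\<close> are continuous across it.\<close>
  have "(F has_real_derivative G T) (at T)"
  proof (rule has_derivative_at_exceptional_point[of r0 _ c])
    have sub: "continuous_on {r0..c} \<rho>'" by (rule continuous_on_subset[OF cont']) (use r0 in auto)
    have "\<rho>' r \<noteq> 0" if "r \<in> {r0..c}" for r using pos[of r] r0 that by auto
    then show "continuous_on {r0..c} F"
      unfolding F_def by (intro continuous_intros sub) auto
    have "continuous_on {0..c} (LE_mass d \<rho>')"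
      unfolding LE_mass_def[abs_def] by (intro continuous_intros indefinite_integral_continuous_1 int) simp
    then have "continuous_on {r0..c} (LE_mass d \<rho>')"
      by (rule continuous_on_subset) (use r0 in auto)
    then show "continuous_on {r0..c} G"
      unfolding G_def[abs_def] using r0 by (intro continuous_intros sub) auto
  qed (use r0 c dF in auto)
  then have dF: "(F has_real_derivative G r) (at r)" if "0 < r" "r < c" for r
    using dF[of r] that by (cases "r = T") auto
  have "LE_solution d \<gamma> \<rho>0 \<rho>' (ereal c)"
    unfolding LE_solution_def
  proof (intro conjI allI impI)
    show "0 < ereal c" using T0 c by simp
    show "\<rho>' 0 = \<rho>0" using sol T0 by (simp add: \<rho>'_def LE_solution_def)
    show "continuous_on {r. 0 \<le> r \<and> ereal r < ereal c} \<rho>'"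
      by (rule continuous_on_subset[OF cont']) auto
    show "0 < \<rho>' r" if "0 \<le> r \<and> ereal r < ereal c" for r using pos[of r] that by simp
    show "((\<lambda>s. \<rho>' s powr \<gamma>) has_real_derivative - \<rho>' r * LE_mass d \<rho>' r / r ^ (d - 1)) (at r)"
      if "0 < r \<and> ereal r < ereal c" for r
      using dF[of r] that unfolding F_def[abs_def] G_def by simp
  qed
  moreover have "R < ereal c" using T c by simp
  moreover have "\<rho>' r = \<rho> r" if "0 \<le> r" "ereal r < R" for r using that T by (simp add: \<rho>'_def)
  ultimately show thesis using that by blast
qed

end

subsection \<open>Convergence to the singular solution\<close>

text \<open>Compare \<open>f\<close> with the parabolas through \<open>z\<close>: the derivative of
  each difference has the sign of u - z, so the difference is minimal at \<open>z\<close>, where it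
  vanishes.\<close>

lemma quadratic_bounds_of_derivative:
  fixes f :: "real \<Rightarrow> real"
  assumes "z \<in> {a..b}" "u \<in> {a..b}" "f z = 0"
    and der: "\<And>u. u \<in> {a..b} \<Longrightarrow> (f has_real_derivative f' u) (at u)"
    and lo: "\<And>u. u \<in> {a..b} \<Longrightarrow> lo * (u - z)\<^sup>2 \<le> f' u * (u - z)"
    and hi: "\<And>u. u \<in> {a..b} \<Longrightarrow> f' u * (u - z) \<le> hi * (u - z)\<^sup>2"
  shows "lo / 2 * (u - z)\<^sup>2 \<le> f u" "f u \<le> hi / 2 * (u - z)\<^sup>2"
proof -
  have "0 \<le> f u - lo / 2 * (u - z)\<^sup>2"
  proof (rule nonneg_if_derivative_sign[OF assms(1,2)])
    fix v assume v: "v \<in> {a..b}"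
    show "((\<lambda>u. f u - lo / 2 * (u - z)\<^sup>2) has_real_derivative f' v - lo * (v - z)) (at v)"
      by (auto intro!: derivative_eq_intros der v)
    show "0 \<le> (f' v - lo * (v - z)) * (v - z)"
      using lo[OF v] by (simp add: power2_eq_square algebra_simps)
  qed (simp add: assms)
  then show "lo / 2 * (u - z)\<^sup>2 \<le> f u" by simp
  have "0 \<le> hi / 2 * (u - z)\<^sup>2 - f u"
  proof (rule nonneg_if_derivative_sign[OF assms(1,2)])
    fix v assume v: "v \<in> {a..b}"
    show "((\<lambda>u. hi / 2 * (u - z)\<^sup>2 - f u) has_real_derivative hi * (v - z) - f' v) (at v)"
      by (auto intro!: derivative_eq_intros der v)
    show "0 \<le> (hi * (v - z) - f' v) * (v - z)"
      using hi[OF v] by (simp add: power2_eq_square algebra_simps)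
  qed (simp add: assms)
  then show "f u \<le> hi / 2 * (u - z)\<^sup>2" by simp
qed

context lane_emden begin

definition x_lim :: real where "x_lim = (\<gamma> * B / (4 * pi)) powr (1 / (2 - \<gamma>))"

lemma x_lim_pos: "0 < x_lim"
  using B_pos \<gamma>1 by (simp add: x_lim_def)

text \<open>Shows \<open>x_lim\<close> as the only positive zero of \<open>g\<close> and reduces the
  size of \<open>g\<close> near it to a difference of powers with exponent 2 - \<gamma>, to which
  \<open>powr_diff_bounds\<close> applies.\<close>

lemma g_factor:
  assumes "0 < u"
  shows "g u = 4 * pi / \<gamma> * u powr (\<gamma> - 1) * (u powr (2 - \<gamma>) - x_lim powr (2 - \<gamma>))"
proof -
  have "x_lim powr (2 - \<gamma>) = \<gamma> * B / (4 * pi)"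
    using B_pos \<gamma>1 \<gamma>_lt_2 by (simp add: x_lim_def powr_powr)
  moreover have "u = u powr (\<gamma> - 1) * u powr (2 - \<gamma>)"
    using assms by (simp flip: powr_add)
  then have "g u = 4 * pi / \<gamma> * (u powr (\<gamma> - 1) * u powr (2 - \<gamma>)) - B * u powr (\<gamma> - 1)"
    unfolding g_def B_def by (metis (no_types))
  ultimately show ?thesis using \<gamma>1 by (simp add: right_diff_distrib)
qed

lemma decay_eventually:
  assumes "R = \<infinity>"
  obtains r0 c K where "0 < r0" "0 < c" "0 < K"
    "\<And>r. r0 \<le> r \<Longrightarrow> \<bar>X r - x_lim\<bar> \<le> K * r powr (- c)"
    "\<And>r. r0 \<le> r \<Longrightarrow> \<bar>Y r - \<gamma> * \<alpha> * x_lim powr (\<gamma> - 1)\<bar> \<le> K * r powr (- c)"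
proof -
  obtain r0 a' b' where r0: "0 < r0" and a': "0 < a'" and tr: "\<And>r. r0 \<le> r \<Longrightarrow> X r \<in> {a'..b'}"
    using trapped assms by (metis ereal_less_PInfty PInfty_neq_ereal(1) less_ereal.simps(2))
  \<comment> \<open>The trap need not contain \<open>x_lim\<close> a priori; it is enlarged because
    the decay lemma wants the rest point inside the interval.\<close>
  define a b where "a = min a' x_lim" and "b = max b' x_lim"
  have a: "0 < a" and ab: "a \<le> b" and z: "x_lim \<in> {a..b}"
    using a' x_lim_pos by (auto simp: a_def b_def)
  have Xab: "X r \<in> {a..b}" if "r0 \<le> r" for r using tr[OF that] by (auto simp: a_def b_def)
  obtain lo hi where lh: "0 < lo" "0 < hi" "\<And>x y. x \<in> {a..b} \<Longrightarrow> y \<in> {a..b} \<Longrightarrow>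
       \<exists>k\<in>{lo..hi}. x powr (2 - \<gamma>) - y powr (2 - \<gamma>) = (2 - \<gamma>) * k * (x - y)"
    using powr_diff_bounds[OF a ab, of "2 - \<gamma>"] by metis
  obtain lo' hi' where lh': "0 < lo'" "0 < hi'" "\<And>x y. x \<in> {a..b} \<Longrightarrow> y \<in> {a..b} \<Longrightarrow>
       \<exists>k\<in>{lo'..hi'}. x powr (\<gamma> - 1) - y powr (\<gamma> - 1) = (\<gamma> - 1) * k * (x - y)"
    using powr_diff_bounds[OF a ab, of "\<gamma> - 1"] by metis
  define C where "C = 4 * pi / \<gamma> * (2 - \<gamma>)"
  have C: "0 < C" using \<gamma>1 \<gamma>_lt_2 by (simp add: C_def)
  define \<kappa>1 \<kappa>2 where "\<kappa>1 = C * (a powr (\<gamma> - 1) * lo)" and "\<kappa>2 = C * (b powr (\<gamma> - 1) * hi)"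
  have \<kappa>: "0 < \<kappa>1" "0 < \<kappa>2" using C a ab lh by (simp_all add: \<kappa>1_def \<kappa>2_def)
  have gz: "\<kappa>1 * (u - x_lim)\<^sup>2 \<le> g u * (u - x_lim) \<and> g u * (u - x_lim) \<le> \<kappa>2 * (u - x_lim)\<^sup>2"
    if u: "u \<in> {a..b}" for u
  proof -
    obtain k where k: "k \<in> {lo..hi}"
      "u powr (2 - \<gamma>) - x_lim powr (2 - \<gamma>) = (2 - \<gamma>) * k * (u - x_lim)"
      using lh(3)[OF u z] by blast
    have "g u * (u - x_lim) = C * (u powr (\<gamma> - 1) * k) * (u - x_lim)\<^sup>2"
      using g_factor[of u] u a unfolding k(2) C_def by (simp add: power2_eq_square)
    moreover have "a powr (\<gamma> - 1) * lo \<le> u powr (\<gamma> - 1) * k" "u powr (\<gamma> - 1) * k \<le> b powr (\<gamma> - 1) * hi"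
      using u k(1) a lh \<gamma>1 by (auto intro!: mult_mono powr_mono2)
    then have "\<kappa>1 \<le> C * (u powr (\<gamma> - 1) * k)" "C * (u powr (\<gamma> - 1) * k) \<le> \<kappa>2"
      using C unfolding \<kappa>1_def \<kappa>2_def by (auto intro: mult_left_mono)
    ultimately show ?thesis by (simp add: mult_right_mono)
  qed
  have k: "a powr (2 - \<gamma>) \<le> u powr (2 - \<gamma>) \<and> u powr (2 - \<gamma>) \<le> b powr (2 - \<gamma>)" if "u \<in> {a..b}" for u
    using that a \<gamma>_lt_2 by (auto intro!: powr_mono2)
  \<comment> \<open>Normalised to vanish at the rest point, so that it is comparable with
    \<open>(u - x_lim)\<^sup>2\<close>.\<close>
  define W where "W u = V u - V x_lim" for u
  have dW: "(W has_real_derivative g u / u powr (2 - \<gamma>)) (at u)" if "u \<in> {a..b}" for u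
    unfolding W_def[abs_def] using deriv_V[of u] that a by (auto intro!: derivative_eq_intros)
  have Wlo: "\<kappa>1 / b powr (2 - \<gamma>) * (u - x_lim)\<^sup>2 \<le> g u / u powr (2 - \<gamma>) * (u - x_lim)"
    and Whi: "g u / u powr (2 - \<gamma>) * (u - x_lim) \<le> \<kappa>2 / a powr (2 - \<gamma>) * (u - x_lim)\<^sup>2"
    if u: "u \<in> {a..b}" for u
  proof -
    have pos: "0 < a powr (2 - \<gamma>)" "0 < u powr (2 - \<gamma>)" using a u by auto
    have "\<kappa>1 * (u - x_lim)\<^sup>2 / b powr (2 - \<gamma>) \<le> g u * (u - x_lim) / u powr (2 - \<gamma>)"
      using gz[OF u] k[OF u] pos \<kappa> by (intro frac_le) (auto intro: order_trans[rotated])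
    moreover have "g u * (u - x_lim) / u powr (2 - \<gamma>) \<le> \<kappa>2 * (u - x_lim)\<^sup>2 / a powr (2 - \<gamma>)"
      using gz[OF u] k[OF u] pos \<kappa> by (intro frac_le) (auto intro: order_trans[rotated])
    ultimately show
      "\<kappa>1 / b powr (2 - \<gamma>) * (u - x_lim)\<^sup>2 \<le> g u / u powr (2 - \<gamma>) * (u - x_lim)"
      "g u / u powr (2 - \<gamma>) * (u - x_lim) \<le> \<kappa>2 / a powr (2 - \<gamma>) * (u - x_lim)\<^sup>2"
      by simp_all
  qed
  have W: "\<kappa>1 / b powr (2 - \<gamma>) / 2 * (u - x_lim)\<^sup>2 \<le> W u \<and> W u \<le> \<kappa>2 / a powr (2 - \<gamma>) / 2 * (u - x_lim)\<^sup>2"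
    if "u \<in> {a..b}" for u
    by (intro conjI quadratic_bounds_of_derivative[OF z that _ dW Wlo Whi]) (simp_all add: W_def)
  obtain c D where cD: "0 < c" "0 < D"
    "\<And>r. r0 \<le> r \<Longrightarrow> \<bar>X r - x_lim\<bar> \<le> D * r powr (- c)"
    "\<And>r. r0 \<le> r \<Longrightarrow> \<bar>P r\<bar> \<le> D * r powr (- c)"
  proof (rule damped_oscillator_decay[where ?r0.0 = r0 and \<delta> = \<delta> and \<kappa> = \<kappa>1 and z = x_lim and a = a and b = b
        and ?c1.0 = "\<kappa>1 / b powr (2 - \<gamma>) / 2" and ?c2.0 = "\<kappa>2 / a powr (2 - \<gamma>) / 2"
        and x = X and p = P and k = "\<lambda>u. u powr (2 - \<gamma>)" and g = g and W = W and K = "b powr (2 - \<gamma>)"])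
    show "0 < u powr (2 - \<gamma>) \<and> u powr (2 - \<gamma>) \<le> b powr (2 - \<gamma>)" if "u \<in> {a..b}" for u
      using k[OF that] that a by auto
    show "(X has_real_derivative X r powr (2 - \<gamma>) * P r / r) (at r)" if "r0 \<le> r" for r
      using deriv_X[of r] that r0 assms by simp
    show "(P has_real_derivative (- \<delta> * P r - g (X r)) / r) (at r)" if "r0 \<le> r" for r
      using deriv_P[of r] that r0 assms by simp
  qed (use r0 \<delta>_pos \<kappa> a ab z Xab dW gz W in auto)
  \<comment> \<open>The first entry serves \<open>X\<close>. The second serves \<open>Y\<close>,
    recovered as \<gamma> times \<open>\<alpha> * X powr (\<gamma> - 1) - P\<close>, where
    \<open>(\<gamma> - 1) * hi'\<close> is a Lipschitz constant of the power.\<close>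
  define K where "K = max D (\<gamma> * (\<alpha> * ((\<gamma> - 1) * hi')) * D + \<gamma> * D)"
  show thesis
  proof (rule that[of r0 c K])
    show "0 < K" using cD by (simp add: K_def less_max_iff_disj)
    fix r assume r: "r0 \<le> r"
    have "D * r powr (- c) \<le> K * r powr (- c)" by (intro mult_right_mono) (auto simp: K_def)
    with cD(3)[OF r] show "\<bar>X r - x_lim\<bar> \<le> K * r powr (- c)" by linarith
    have "Y r - \<gamma> * \<alpha> * x_lim powr (\<gamma> - 1) =
        \<gamma> * (\<alpha> * (X r powr (\<gamma> - 1) - x_lim powr (\<gamma> - 1))) - \<gamma> * P r"
      using \<gamma>1 by (simp add: P_def field_simps)
    then have "\<bar>Y r - \<gamma> * \<alpha> * x_lim powr (\<gamma> - 1)\<bar> \<le>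
        \<bar>\<gamma> * (\<alpha> * (X r powr (\<gamma> - 1) - x_lim powr (\<gamma> - 1)))\<bar> + \<bar>\<gamma> * P r\<bar>"
      by linarith
    also have "\<dots> = \<gamma> * (\<alpha> * \<bar>X r powr (\<gamma> - 1) - x_lim powr (\<gamma> - 1)\<bar>) + \<gamma> * \<bar>P r\<bar>"
      using \<gamma>1 \<alpha>_pos by (simp add: abs_mult)
    also have "\<dots> \<le> \<gamma> * (\<alpha> * ((\<gamma> - 1) * hi' * (D * r powr (- c)))) + \<gamma> * (D * r powr (- c))"
    proof -
      obtain k where k: "k \<in> {lo'..hi'}"
        "X r powr (\<gamma> - 1) - x_lim powr (\<gamma> - 1) = (\<gamma> - 1) * k * (X r - x_lim)"
        using lh'(3)[OF Xab[OF r] z] by blast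
      have "\<bar>X r powr (\<gamma> - 1) - x_lim powr (\<gamma> - 1)\<bar> = (\<gamma> - 1) * k * \<bar>X r - x_lim\<bar>"
        using k lh' \<gamma>1 by (simp add: abs_mult)
      also have "\<dots> \<le> (\<gamma> - 1) * hi' * (D * r powr (- c))"
        using k(1) lh' \<gamma>1 cD(3)[OF r] by (intro mult_mono) auto
      finally show ?thesis
        using \<gamma>1 \<alpha>_pos cD(4)[OF r] by (intro add_mono mult_left_mono) auto
    qed
    also have "\<dots> = (\<gamma> * (\<alpha> * ((\<gamma> - 1) * hi')) * D + \<gamma> * D) * r powr (- c)"
      by (simp add: algebra_simps)
    also have "\<dots> \<le> K * r powr (- c)" by (intro mult_right_mono) (auto simp: K_def)
    finally show "\<bar>Y r - \<gamma> * \<alpha> * x_lim powr (\<gamma> - 1)\<bar> \<le> K * r powr (- c)" .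
  qed (use r0 cD in auto)
qed

lemma bounded_near_0:
  assumes "0 < r0" "ereal r0 < R"
  obtains D where "\<And>r. 0 < r \<Longrightarrow> r \<le> r0 \<Longrightarrow> \<bar>X r\<bar> \<le> D" "\<And>r. 0 < r \<Longrightarrow> r \<le> r0 \<Longrightarrow> \<bar>Y r\<bar> \<le> D"
proof -
  have "compact (\<rho> ` {0..r0})" using assms by (intro compact_continuous_image cont_Icc) auto
  then obtain M where M: "0 < M" "\<And>s. s \<in> {0..r0} \<Longrightarrow> \<bar>\<rho> s\<bar> \<le> M"
    by (metis compact_imp_bounded bounded_pos imageI real_norm_def)
  show thesis
  \<comment> \<open>The factor 4 pi comes from the mass bound for \<open>Y\<close>; since it exceeds
    1, the same constant serves \<open>X\<close>.\<close>
  proof (rule that[of "4 * pi * M * r0 powr \<alpha>"])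
    fix r assume r: "0 < r" "r \<le> r0"
    then have rR: "ereal r < R" using less_R assms by blast
    have p: "r powr \<alpha> \<le> r0 powr \<alpha>" using r \<alpha>_pos by (intro powr_mono2) auto
    have "\<bar>X r\<bar> \<le> r0 powr \<alpha> * M"
      using p M(2)[of r] M(1) r by (auto simp: X_def abs_mult intro!: mult_mono)
    also have "\<dots> \<le> 4 * pi * (r0 powr \<alpha> * M)"
    proof -
      have "1 \<le> 4 * pi" using pi_gt3 by simp
      from mult_right_mono[OF this, of "r0 powr \<alpha> * M"] M show ?thesis by simp
    qed
    finally show "\<bar>X r\<bar> \<le> 4 * pi * M * r0 powr \<alpha>" by (simp add: mult_ac)
    have "\<rho> s \<le> M" if "s \<in> {0..r}" for s using M(2)[of s] that r by auto
    then have "m r \<le> 4 * pi * M * r ^ d" using r rR by (intro m_le) auto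
    then have "Y r \<le> r powr (\<alpha> - real d) * (4 * pi * M * r powr real d)"
      using r unfolding Y_def by (intro mult_left_mono) (auto simp: powr_realpow)
    also have "\<dots> = 4 * pi * M * (r powr (\<alpha> - real d) * r powr real d)" by simp
    also have "r powr (\<alpha> - real d) * r powr real d = r powr \<alpha>" by (simp flip: powr_add)
    also have "4 * pi * M * r powr \<alpha> \<le> 4 * pi * M * r0 powr \<alpha>"
      using p M by (intro mult_left_mono) auto
    finally show "\<bar>Y r\<bar> \<le> 4 * pi * M * r0 powr \<alpha>"
      using m_nonneg[of r] r rR by (simp add: Y_def)
  qed
qed

lemma decay:
  assumes "R = \<infinity>"
  obtains c K where "0 < c" "0 < K"
    "\<And>r. 0 < r \<Longrightarrow> \<bar>X r - x_lim\<bar> \<le> K * r powr (- c)"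
    "\<And>r. 0 < r \<Longrightarrow> \<bar>Y r - \<gamma> * \<alpha> * x_lim powr (\<gamma> - 1)\<bar> \<le> K * r powr (- c)"
proof -
  define y where "y = \<gamma> * \<alpha> * x_lim powr (\<gamma> - 1)"
  obtain r0 c K where K: "0 < r0" "0 < c" "0 < K"
    "\<And>r. r0 \<le> r \<Longrightarrow> \<bar>X r - x_lim\<bar> \<le> K * r powr (- c)"
    "\<And>r. r0 \<le> r \<Longrightarrow> \<bar>Y r - y\<bar> \<le> K * r powr (- c)"
    using decay_eventually[OF assms] unfolding y_def by metis
  obtain D where D: "\<And>r. 0 < r \<Longrightarrow> r \<le> r0 \<Longrightarrow> \<bar>X r\<bar> \<le> D" "\<And>r. 0 < r \<Longrightarrow> r \<le> r0 \<Longrightarrow> \<bar>Y r\<bar> \<le> D"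
    using bounded_near_0[of r0] K assms by auto
  define L where "L = D + \<bar>x_lim\<bar> + \<bar>y\<bar>"
  have "0 \<le> L" using D(1)[of r0] K(1) by (simp add: L_def)
  \<comment> \<open>On \<open>(0, r0]\<close> the function \<open>r powr (- c)\<close> is at least
    \<open>r0 powr (- c)\<close>, so this constant dominates the bound \<open>L\<close> valid
    there.\<close>
  define K' where "K' = max K (L * r0 powr c)"
  have far: "K * r powr (- c) \<le> K' * r powr (- c)" for r by (intro mult_right_mono) (auto simp: K'_def)
  have near: "L \<le> K' * r powr (- c)" if "0 < r" "r \<le> r0" for r
  proof -
    have "L * 1 \<le> L * (r0 powr c * r powr (- c))"
    proof (intro mult_left_mono \<open>0 \<le> L\<close>)
      have "r powr c \<le> r0 powr c" using that K by (intro powr_mono2) auto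
      then show "1 \<le> r0 powr c * r powr (- c)" using that by (simp add: powr_minus field_simps)
    qed
    also have "\<dots> = (L * r0 powr c) * r powr (- c)" by simp
    also have "\<dots> \<le> K' * r powr (- c)" by (intro mult_right_mono) (auto simp: K'_def)
    finally show ?thesis by simp
  qed
  show thesis
  proof (rule that[of c K'])
    fix r :: real assume r: "0 < r"
    show "\<bar>X r - x_lim\<bar> \<le> K' * r powr (- c)"
    proof (cases "r0 \<le> r")
      case True
      then show ?thesis using K(4) far order_trans by blast
    next
      case False
      then have "\<bar>X r - x_lim\<bar> \<le> L" using D(1)[of r] r unfolding L_def by linarith
      then show ?thesis using near[of r] r False by linarith
    qed
    show "\<bar>Y r - \<gamma> * \<alpha> * x_lim powr (\<gamma> - 1)\<bar> \<le> K' * r powr (- c)"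
      unfolding y_def[symmetric]
    proof (cases "r0 \<le> r")
      case True
      then show "\<bar>Y r - y\<bar> \<le> K' * r powr (- c)" using K(5) far order_trans by blast
    next
      case False
      then have "\<bar>Y r - y\<bar> \<le> L" using D(2)[of r] r unfolding L_def by linarith
      then show "\<bar>Y r - y\<bar> \<le> K' * r powr (- c)" using near[of r] r False by linarith
    qed
  qed (use K in \<open>auto simp: K'_def less_max_iff_disj\<close>)
qed

end

theorem mainTheorem13:
  fixes d :: nat and \<gamma> \<rho>0 :: real and \<rho> :: "real \<Rightarrow> real" and Rg :: ereal
  assumes "d \<ge> 3" and "1 \<le> \<gamma>" and "\<gamma> < 2 * real d / (real d + 2)"
    and "\<rho>0 > 0" and "LE_profile d \<gamma> \<rho>0 \<rho> Rg"
  defines "A \<equiv> (1 / (2 * pi)) * ((- real d * \<gamma>\<^sup>2 + 2 * (real d - 1) * \<gamma>) / (2 - \<gamma>)\<^sup>2)"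
  defines "v1 \<equiv> A powr (1 / (2 - \<gamma>))"
    and "v2 \<equiv> (2 * \<gamma> / (2 - \<gamma>)) * A powr ((\<gamma> - 1) / (2 - \<gamma>))"
  shows "Rg = \<infinity> \<and>
    (\<exists>c K. c > 0 \<and> K > 0 \<and>
      (\<forall>r > 0. \<bar>r powr (2 / (2 - \<gamma>)) * \<rho> r - v1\<bar> \<le> K * r powr (- c) \<and>
               \<bar>r powr (2 / (2 - \<gamma>) - real d) * LE_mass d \<rho> r - v2\<bar> \<le> K * r powr (- c)))"
proof -
  interpret lane_emden d \<gamma> \<rho>0 \<rho> Rg
    using assms(1-3,5) by unfold_locales (auto simp: LE_profile_def)
  have R: "Rg = \<infinity>"
  \<comment> \<open>A finite \<open>Rg\<close> contradicts maximality, because the solution extends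
    beyond it.\<close>
  proof (cases Rg)
    case (real T)
    then show ?thesis using extends_beyond assms(5) unfolding LE_profile_def by metis
  next
    case MInf
    then show ?thesis using R_pos by simp
  qed
  have "\<gamma> * B / (4 * pi) = A"
    using \<gamma>_lt_2 unfolding A_def B_def \<alpha>_def
    by (simp add: divide_simps) (simp add: power2_eq_square algebra_simps)
  then have x: "x_lim = v1" by (simp add: x_lim_def v1_def)
  have "0 < A" using \<open>\<gamma> * B / (4 * pi) = A\<close> B_pos \<gamma>1 by (simp flip: \<open>\<gamma> * B / (4 * pi) = A\<close>)
  \<comment> \<open>The left side is the value of \<open>Y\<close> at the rest point, where P = 0
    and X = \<open>x_lim\<close>.\<close>
  then have y: "\<gamma> * \<alpha> * x_lim powr (\<gamma> - 1) = v2"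
    by (simp add: x v1_def v2_def \<alpha>_def powr_powr)
  obtain c K where "0 < c" "0 < K"
    "\<And>r. 0 < r \<Longrightarrow> \<bar>X r - v1\<bar> \<le> K * r powr (- c)"
    "\<And>r. 0 < r \<Longrightarrow> \<bar>Y r - v2\<bar> \<le> K * r powr (- c)"
    using decay[OF R] unfolding x[symmetric] y[symmetric] by metis
  then show ?thesis using R unfolding X_def Y_def \<alpha>_def by blast
qed

end
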